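(* Let $N\ge 2$ and let $\Omega\subset\mathbb{R}^N$ be a bounded domain of class $C^2$ with $0\in\partial\Omega$. Assume that either (a) $H(x,t,\xi)=t^p|\xi|^q$ with $p>0$, $0\le q\le2$ and $N(p+q-1)\ge p+1$; or (b) $H(x,t,\xi)=t^p+|\xi|^q$ with $p\ge1$, $1\le q\le2$ and $\max\{p,\frac{q}{2-q}\}\ge\frac{N+1}{N-1}$ (with $\frac{q}{2-q}:=+\infty$ if $q=2$). If $u\in C(\overline\Omega\setminus\{0\})\cap C^2(\Omega)$ is a nonnegative solution of $$-\Delta u+H(x,u,\nabla u)=0\quad\text{in }\Omega$$ vanishing on $\partial\Omega\setminus\{0\}$, then $u\equiv0$. *)

theory Defs
  imports "HOL-Analysis.Analysis"
begin

text \<open>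
  \<open>C\<^sup>k\<close> regularity on an open set \<open>S\<close>: at each stage all directional derivatives exist and are
  again of class \<open>C\<^sup>k\<^sup>-\<^sup>1\<close>.
\<close>

primrec Ck_on :: "nat \<Rightarrow> ('a::euclidean_space \<Rightarrow> 'b::real_normed_vector) \<Rightarrow> 'a set \<Rightarrow> bool" where
  "Ck_on 0 f S \<longleftrightarrow> continuous_on S f"
| "Ck_on (Suc k) f S \<longleftrightarrow>
     (\<forall>x\<in>S. f differentiable (at x)) \<and>
     (\<forall>v. Ck_on k (\<lambda>x. frechet_derivative f (at x) v) S)"

definition partial_deriv :: "'a::euclidean_space \<Rightarrow> ('a \<Rightarrow> real) \<Rightarrow> 'a \<Rightarrow> real" where
  "partial_deriv b u x = frechet_derivative u (at x) b"

definition gradient :: "('a::euclidean_space \<Rightarrow> real) \<Rightarrow> 'a \<Rightarrow> 'a" where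
  "gradient u x = (\<Sum>b\<in>Basis. partial_deriv b u x *\<^sub>R b)"

definition laplacian :: "('a::euclidean_space \<Rightarrow> real) \<Rightarrow> 'a \<Rightarrow> real" where
  "laplacian u x = (\<Sum>b\<in>Basis. partial_deriv b (partial_deriv b u) x)"

text \<open>
  Locally, \<open>\<Omega>\<close> lies strictly above the graph of a \<open>C\<^sup>k\<close> function in some orthonormal frame whose last
  vector is \<open>e\<close>. The argument \<open>x - (x \<bullet> e) *\<^sub>R e\<close> is the projection of \<open>x\<close> onto the hyperplane
  orthogonal to \<open>e\<close>, so only the values of \<open>\<gamma>\<close> on that \<open>(N-1)\<close>-dimensional space matter.
\<close>

definition Ck_boundary :: "nat \<Rightarrow> 'a::euclidean_space set \<Rightarrow> bool" where
  "Ck_boundary k \<Omega> \<longleftrightarrow>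
     (\<forall>x0\<in>frontier \<Omega>. \<exists>r>0. \<exists>e \<gamma>. norm e = 1 \<and> Ck_on k (\<gamma> :: 'a \<Rightarrow> real) UNIV \<and>
        \<Omega> \<inter> ball x0 r = {x \<in> ball x0 r. x \<bullet> e > \<gamma> (x - (x \<bullet> e) *\<^sub>R e)})"

definition bounded_Ck_domain :: "nat \<Rightarrow> 'a::euclidean_space set \<Rightarrow> bool" where
  "bounded_Ck_domain k \<Omega> \<longleftrightarrow>
     open \<Omega> \<and> connected \<Omega> \<and> \<Omega> \<noteq> {} \<and> bounded \<Omega> \<and> Ck_boundary k \<Omega>"

text \<open>
  Powers of a nonnegative base with \<open>s\<^sup>0 = 1\<close> for every \<open>s\<close>, whereas \<open>0 powr 0 = 0\<close>.
\<close>

definition rpow :: "real \<Rightarrow> real \<Rightarrow> real" where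
  "rpow s q = (if q = 0 then 1 else s powr q)"

text \<open>
  The value of \<open>u\<close> at the origin is irrelevant and left unconstrained.
\<close>

definition nonneg_solution ::
    "('a::euclidean_space \<Rightarrow> real \<Rightarrow> 'a \<Rightarrow> real) \<Rightarrow> 'a set \<Rightarrow> ('a \<Rightarrow> real) \<Rightarrow> bool" where
  "nonneg_solution H \<Omega> u \<longleftrightarrow>
     continuous_on (closure \<Omega> - {0}) u \<and> Ck_on 2 u \<Omega> \<and>
     (\<forall>x\<in>closure \<Omega> - {0}. u x \<ge> 0) \<and>
     (\<forall>x\<in>\<Omega>. - laplacian u x + H x (u x) (gradient u x) = 0)"

end

theory Submission
  imports Defs
begin

text \<open>
  In both cases \<open>u\<close> satisfies \<open>\<Delta>u \<ge> u\<^sup>p|\<nabla>u|\<^sup>q\<close> for some exponents with \<open>N (p + q - 1) \<ge> p + 1\<close>: in (b)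
  drop one of the two terms, i.e. replace its exponent by \<open>0\<close> in the product. Since \<open>\<Omega>\<close> is of class
  \<open>C\<^sup>2\<close>, it lies outside a ball touching \<open>\<Omega>\<close> at \<open>0\<close>; let \<open>P\<close> be the Poisson kernel of the exterior of
  that ball with pole \<open>0\<close>. Comparison at an interior maximum of \<open>u - w\<close> with explicit supersolutions \<open>w\<close>
  gives, in turn: \<open>u \<le> A |x|\<^sup>1\<^sup>-\<^sup>N\<close>, from the blow-up function \<open>A (|x| - \<epsilon>)\<^sup>1\<^sup>-\<^sup>N\<close>; \<open>u \<le> k P\<close>, from Poisson
  kernels whose pole is moved slightly into the ball; and, whenever \<open>u \<le> k P\<close> with \<open>k > 0\<close>, the
  improvement \<open>u \<le> (k - \<delta>) P\<close>. Hence the least admissible \<open>k\<close> is \<open>0\<close>.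
\<close>

subsection \<open>Gradients, Laplacians and comparison\<close>

text \<open>A relation at a point, so that gradient and Laplacian of explicit barriers can be
  computed together by rules, as with \<open>has_derivative\<close>. The gradient field
  \<open>G\<close> must exist near \<open>x\<close> but be differentiable only at \<open>x\<close>;
  the trace of its derivative is the Laplacian.\<close>

definition has_grad_lap :: "('a::euclidean_space \<Rightarrow> real) \<Rightarrow> 'a \<Rightarrow> real \<Rightarrow> 'a \<Rightarrow> bool" where
  "has_grad_lap f g L x \<longleftrightarrow>
     (\<exists>G G'. (\<forall>\<^sub>F y in nhds x. (f has_derivative (\<lambda>h. G y \<bullet> h)) (at y)) \<and>
        (G has_derivative G') (at x) \<and> G x = g \<and> (\<Sum>b\<in>Basis. G' b \<bullet> b) = L)"

section \<open>Calculus rules for gradient and Laplacian\<close>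

lemma has_grad_lapI:
  assumes "\<forall>\<^sub>F y in nhds x. (f has_derivative (\<lambda>h. G y \<bullet> h)) (at y)" "(G has_derivative G') (at x)"
    "G x = g" "(\<Sum>b\<in>Basis. G' b \<bullet> b) = L"
  shows "has_grad_lap f g L x"
  unfolding has_grad_lap_def using assms by blast

lemma has_grad_lap_continuous: "has_grad_lap f g L x \<Longrightarrow> isCont f x"
  unfolding has_grad_lap_def
  by (meson eventually_nhds_x_imp_x has_derivative_continuous)

lemma has_grad_lap_const: "has_grad_lap (\<lambda>x. k) 0 0 x"
  by (rule has_grad_lapI[where G = "\<lambda>x. 0" and G' = "\<lambda>x. 0"]) (auto intro!: always_eventually)

lemma has_grad_lap_inner: "has_grad_lap (\<lambda>x. x \<bullet> c) c 0 x"
  by (rule has_grad_lapI[where G = "\<lambda>x. c" and G' = "\<lambda>x. 0"])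
     (auto intro!: always_eventually derivative_eq_intros simp: inner_commute)

lemma has_grad_lap_inner_self:
  fixes x :: "'a::euclidean_space"
  shows "has_grad_lap (\<lambda>x. x \<bullet> x) (2 *\<^sub>R x) (2 * real DIM('a)) x"
  by (rule has_grad_lapI[where G = "\<lambda>x. 2 *\<^sub>R x" and G' = "\<lambda>h. 2 *\<^sub>R h"])
     (auto intro!: always_eventually derivative_eq_intros simp: inner_commute)

lemma has_grad_lap_add:
  assumes "has_grad_lap f g L x" "has_grad_lap f' g' L' x"
  shows "has_grad_lap (\<lambda>x. f x + f' x) (g + g') (L + L') x"
proof -
  obtain G DG where G: "\<forall>\<^sub>F y in nhds x. (f has_derivative (\<lambda>h. G y \<bullet> h)) (at y)"
    "(G has_derivative DG) (at x)" "G x = g" "(\<Sum>b\<in>Basis. DG b \<bullet> b) = L"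
    using assms(1) unfolding has_grad_lap_def by blast
  obtain K DK where K: "\<forall>\<^sub>F y in nhds x. (f' has_derivative (\<lambda>h. K y \<bullet> h)) (at y)"
    "(K has_derivative DK) (at x)" "K x = g'" "(\<Sum>b\<in>Basis. DK b \<bullet> b) = L'"
    using assms(2) unfolding has_grad_lap_def by blast
  have 1: "\<forall>\<^sub>F y in nhds x. ((\<lambda>x. f x + f' x) has_derivative (\<lambda>h. (G y + K y) \<bullet> h)) (at y)"
    using G(1) K(1) by eventually_elim (auto intro!: derivative_eq_intros simp: inner_add_left)
  have 2: "((\<lambda>y. G y + K y) has_derivative (\<lambda>h. DG h + DK h)) (at x)"
    by (intro derivative_intros G K)
  have 3: "(\<Sum>b\<in>Basis. (DG b + DK b) \<bullet> b) = L + L'"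
    using G(4) K(4) by (simp add: inner_add_left sum.distrib)
  show ?thesis
    by (rule has_grad_lapI[OF 1 2]) (use 3 G(3) K(3) in auto)
qed

lemma has_grad_lap_mult:
  assumes "has_grad_lap f g L x" "has_grad_lap f' g' L' x"
  shows "has_grad_lap (\<lambda>x. f x * f' x) (f x *\<^sub>R g' + f' x *\<^sub>R g)
           (f x * L' + f' x * L + 2 * (g \<bullet> g')) x"
proof -
  obtain G DG where G: "\<forall>\<^sub>F y in nhds x. (f has_derivative (\<lambda>h. G y \<bullet> h)) (at y)"
    "(G has_derivative DG) (at x)" "G x = g" "(\<Sum>b\<in>Basis. DG b \<bullet> b) = L"
    using assms(1) unfolding has_grad_lap_def by blast
  obtain K DK where K: "\<forall>\<^sub>F y in nhds x. (f' has_derivative (\<lambda>h. K y \<bullet> h)) (at y)"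
    "(K has_derivative DK) (at x)" "K x = g'" "(\<Sum>b\<in>Basis. DK b \<bullet> b) = L'"
    using assms(2) unfolding has_grad_lap_def by blast
  have f: "(f has_derivative (\<lambda>h. g \<bullet> h)) (at x)"
    using eventually_nhds_x_imp_x[OF G(1)] G(3) by simp
  have f': "(f' has_derivative (\<lambda>h. g' \<bullet> h)) (at x)"
    using eventually_nhds_x_imp_x[OF K(1)] K(3) by simp
  have 1: "\<forall>\<^sub>F y in nhds x. ((\<lambda>x. f x * f' x) has_derivative
          (\<lambda>h. (f y *\<^sub>R K y + f' y *\<^sub>R G y) \<bullet> h)) (at y)"
    using G(1) K(1)
    by eventually_elim (auto intro!: derivative_eq_intros simp: inner_add_left algebra_simps)
  have 2: "((\<lambda>y. f y *\<^sub>R K y + f' y *\<^sub>R G y) has_derivative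
      (\<lambda>h. (f x *\<^sub>R DK h + (g \<bullet> h) *\<^sub>R K x) + (f' x *\<^sub>R DG h + (g' \<bullet> h) *\<^sub>R G x))) (at x)"
    by (intro derivative_intros G K f f')
  have 3: "(\<Sum>b\<in>Basis. ((f x *\<^sub>R DK b + (g \<bullet> b) *\<^sub>R K x) + (f' x *\<^sub>R DG b + (g' \<bullet> b) *\<^sub>R G x)) \<bullet> b)
       = f x * L' + f' x * L + 2 * (g \<bullet> g')"
    using G(3,4) K(3,4) euclidean_inner[of g g']
    by (auto simp: inner_add_left sum.distrib mult.commute simp flip: sum_distrib_left)
  show ?thesis
    by (rule has_grad_lapI[OF 1 2]) (use 3 G(3) K(3) in auto)
qed

lemma has_grad_lap_cmult:
  assumes "has_grad_lap f g L x"
  shows "has_grad_lap (\<lambda>x. k * f x) (k *\<^sub>R g) (k * L) x"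
  using has_grad_lap_mult[OF has_grad_lap_const assms, of k] by simp

lemma has_grad_lap_compose:
  assumes f: "has_grad_lap f g L x"
    and \<phi>: "\<forall>\<^sub>F t in nhds (f x). (\<phi> has_real_derivative \<phi>' t) (at t)"
    and \<phi>': "(\<phi>' has_real_derivative d2) (at (f x))"
  shows "has_grad_lap (\<lambda>x. \<phi> (f x)) (\<phi>' (f x) *\<^sub>R g) (d2 * (g \<bullet> g) + \<phi>' (f x) * L) x"
proof -
  obtain G DG where G: "\<forall>\<^sub>F y in nhds x. (f has_derivative (\<lambda>h. G y \<bullet> h)) (at y)"
    "(G has_derivative DG) (at x)" "G x = g" "(\<Sum>b\<in>Basis. DG b \<bullet> b) = L"
    using f unfolding has_grad_lap_def by blast
  have df: "(f has_derivative (\<lambda>h. g \<bullet> h)) (at x)"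
    using eventually_nhds_x_imp_x[OF G(1)] G(3) by simp
  have "filterlim f (nhds (f x)) (nhds x)"
    using has_grad_lap_continuous[OF f] isCont_def tendsto_at_iff_tendsto_nhds by blast
  then have "\<forall>\<^sub>F y in nhds x. (\<phi> has_real_derivative \<phi>' (f y)) (at (f y))"
    using \<phi> unfolding filterlim_iff by blast
  then have 1: "\<forall>\<^sub>F y in nhds x. ((\<lambda>x. \<phi> (f x)) has_derivative (\<lambda>h. (\<phi>' (f y) *\<^sub>R G y) \<bullet> h)) (at y)"
    using G(1)
    by eventually_elim
       (drule DERIV_compose_FDERIV, assumption, simp add: mult.commute)
  have "((\<lambda>y. \<phi>' (f y)) has_derivative (\<lambda>h. (g \<bullet> h) * d2)) (at x)"
    using DERIV_compose_FDERIV[OF \<phi>' df] by simp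
  from has_derivative_scaleR[OF this G(2)]
  have 2: "((\<lambda>y. \<phi>' (f y) *\<^sub>R G y) has_derivative
      (\<lambda>h. \<phi>' (f x) *\<^sub>R DG h + ((g \<bullet> h) * d2) *\<^sub>R G x)) (at x)" .
  have 3: "(\<Sum>b\<in>Basis. (\<phi>' (f x) *\<^sub>R DG b + ((g \<bullet> b) * d2) *\<^sub>R G x) \<bullet> b)
       = d2 * (g \<bullet> g) + \<phi>' (f x) * L"
    using G(3,4) euclidean_inner[of g g]
    by (auto simp: inner_add_left sum.distrib mult_ac simp flip: sum_distrib_left sum_distrib_right)
  show ?thesis
    by (rule has_grad_lapI[OF 1 2]) (use 3 G(3) in auto)
qed

lemma has_grad_lap_shift:
  assumes "has_grad_lap f g L (x + z)"
  shows "has_grad_lap (\<lambda>x. f (x + z)) g L x"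
proof -
  obtain G DG where G: "\<forall>\<^sub>F y in nhds (x + z). (f has_derivative (\<lambda>h. G y \<bullet> h)) (at y)"
    "(G has_derivative DG) (at (x + z))" "G (x + z) = g" "(\<Sum>b\<in>Basis. DG b \<bullet> b) = L"
    using assms unfolding has_grad_lap_def by blast
  have shift: "((\<lambda>x. F (x + z)) has_derivative F') (at y)"
    if "(F has_derivative F') (at (y + z))" for F :: "'a \<Rightarrow> 'b::real_normed_vector" and F' y
    using has_derivative_compose[of "\<lambda>x. x + z" "\<lambda>h. h" y UNIV F F'] that
    by (simp add: has_derivative_add_const o_def)
  have "filterlim (\<lambda>y. y + z) (nhds (x + z)) (nhds x)"
    by (intro tendsto_intros filterlim_ident)
  with G(1) have "\<forall>\<^sub>F y in nhds x. (f has_derivative (\<lambda>h. G (y + z) \<bullet> h)) (at (y + z))"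
    unfolding filterlim_iff by blast
  then have 1: "\<forall>\<^sub>F y in nhds x. ((\<lambda>x. f (x + z)) has_derivative (\<lambda>h. G (y + z) \<bullet> h)) (at y)"
    by eventually_elim (rule shift)
  note 2 = shift[OF G(2)]
  show ?thesis
    by (rule has_grad_lapI[OF 1 2]) (use G(3,4) in auto)
qed

lemma has_grad_lap_norm:
  fixes x :: "'a::euclidean_space"
  assumes "x \<noteq> 0"
  shows "has_grad_lap norm (x /\<^sub>R norm x) ((real DIM('a) - 1) / norm x) x"
proof -
  have pos: "x \<bullet> x > 0" using assms by simp
  have "\<forall>\<^sub>F t in nhds (x \<bullet> x). (sqrt has_real_derivative inverse (sqrt t) / 2) (at t)"
    using eventually_nhds_in_open[of "{0<..}" "x \<bullet> x"] pos
    by (auto elim!: eventually_mono intro!: DERIV_real_sqrt)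
  moreover have "((\<lambda>t. inverse (sqrt t) / 2) has_real_derivative - (1 / (4 * norm x ^ 3))) (at (x \<bullet> x))"
    using assms
    by (auto intro!: derivative_eq_intros simp: power2_norm_eq_inner[symmetric] field_simps eval_nat_numeral)
  ultimately have "has_grad_lap (\<lambda>x. sqrt (x \<bullet> x)) ((inverse (sqrt (x \<bullet> x)) / 2) *\<^sub>R 2 *\<^sub>R x)
     (- (1 / (4 * norm x ^ 3)) * ((2 *\<^sub>R x) \<bullet> (2 *\<^sub>R x)) + inverse (sqrt (x \<bullet> x)) / 2 * (2 * real DIM('a))) x"
    by (rule has_grad_lap_compose[OF has_grad_lap_inner_self])
  moreover have "- (1 / (4 * norm x ^ 3)) * ((2 *\<^sub>R x) \<bullet> (2 *\<^sub>R x)) + inverse (sqrt (x \<bullet> x)) / 2 * (2 * real DIM('a))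
     = (real DIM('a) - 1) / norm x"
    using assms
    by (simp add: power2_norm_eq_inner[symmetric] field_simps eval_nat_numeral)
  moreover have "(\<lambda>x::'a. sqrt (x \<bullet> x)) = norm" by (auto simp: norm_eq_sqrt_inner)
  ultimately show ?thesis by (simp add: norm_eq_sqrt_inner)
qed

lemma has_grad_lap_norm_powr:
  fixes x :: "'a::euclidean_space"
  assumes "x \<noteq> 0"
  shows "has_grad_lap (\<lambda>x. norm x powr \<beta>) ((\<beta> * norm x powr (\<beta> - 2)) *\<^sub>R x)
           (\<beta> * (\<beta> + real DIM('a) - 2) * norm x powr (\<beta> - 2)) x"
proof -
  let ?r = "norm x"
  have pos: "?r > 0" using assms by simp
  have "\<forall>\<^sub>F t in nhds ?r. ((\<lambda>t. t powr \<beta>) has_real_derivative \<beta> * t powr (\<beta> - 1)) (at t)"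
    using eventually_nhds_in_open[of "{0<..}" ?r] pos
    by (auto elim!: eventually_mono intro!: derivative_eq_intros)
  moreover have "((\<lambda>t. \<beta> * t powr (\<beta> - 1)) has_real_derivative \<beta> * (\<beta> - 1) * ?r powr (\<beta> - 2)) (at ?r)"
    using pos by (auto intro!: derivative_eq_intros)
  ultimately have *: "has_grad_lap (\<lambda>x. norm x powr \<beta>) ((\<beta> * ?r powr (\<beta> - 1)) *\<^sub>R (x /\<^sub>R ?r))
      (\<beta> * (\<beta> - 1) * ?r powr (\<beta> - 2) * ((x /\<^sub>R ?r) \<bullet> (x /\<^sub>R ?r))
        + \<beta> * ?r powr (\<beta> - 1) * ((real DIM('a) - 1) / ?r)) x"
    by (rule has_grad_lap_compose[OF has_grad_lap_norm[OF assms]])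
  have eq: "?r powr (\<beta> - 1) = ?r * ?r powr (\<beta> - 2)"
    using pos by (simp add: powr_mult_base)
  have 1: "(x /\<^sub>R ?r) \<bullet> (x /\<^sub>R ?r) = 1"
    using pos by (simp add: dot_square_norm power2_eq_square)
  have "(\<beta> * (?r * ?r powr (\<beta> - 2))) *\<^sub>R (x /\<^sub>R ?r) = (\<beta> * ?r powr (\<beta> - 2)) *\<^sub>R x"
    using pos by simp
  moreover have "\<beta> * (\<beta> - 1) * ?r powr (\<beta> - 2) * 1 + \<beta> * (?r * ?r powr (\<beta> - 2)) * ((real DIM('a) - 1) / ?r)
      = \<beta> * (\<beta> + real DIM('a) - 2) * ?r powr (\<beta> - 2)"
    using pos by (simp add: algebra_simps add_divide_distrib diff_divide_distrib)
  ultimately show ?thesis using *[unfolded eq 1] by metis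
qed

text \<open>Link to the functions of the problem: two levels of \<open>Ck_on\<close> make
  \<open>f\<close> and its partial derivatives differentiable, and linearity of the Frechet
  derivative turns it into the inner product with \<open>gradient f\<close>.\<close>

lemma has_grad_lap_C2:
  assumes "Ck_on 2 f S" "open S" "x \<in> S"
  shows "has_grad_lap f (gradient f x) (laplacian f x) x"
proof -
  have d: "\<And>y. y \<in> S \<Longrightarrow> f differentiable (at y)"
    and pd: "\<And>y b. y \<in> S \<Longrightarrow> partial_deriv b f differentiable (at y)"
    using assms(1) unfolding numeral_2_eq_2 partial_deriv_def[abs_def] by auto
  have 1: "\<forall>\<^sub>F y in nhds x. (f has_derivative (\<lambda>h. gradient f y \<bullet> h)) (at y)"
    using eventually_nhds_in_open[OF assms(2,3)]
  proof eventually_elim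
    case (elim y)
    then have D: "(f has_derivative frechet_derivative f (at y)) (at y)"
      using d frechet_derivative_works by blast
    then have lin: "linear (frechet_derivative f (at y))"
      by (rule has_derivative_linear)
    have "frechet_derivative f (at y) h = gradient f y \<bullet> h" for h
    proof -
      have "frechet_derivative f (at y) h = frechet_derivative f (at y) (\<Sum>b\<in>Basis. (h \<bullet> b) *\<^sub>R b)"
        by (simp add: euclidean_representation)
      also have "\<dots> = gradient f y \<bullet> h"
        by (simp add: linear_sum[OF lin] linear_cmul[OF lin] gradient_def partial_deriv_def
            inner_sum_left mult.commute inner_commute[of h])
      finally show ?thesis .
    qed
    with D show ?case by (metis (no_types, lifting) ext)
  qed
  have 2: "(gradient f has_derivative
      (\<lambda>h. \<Sum>b\<in>Basis. frechet_derivative (partial_deriv b f) (at x) h *\<^sub>R b)) (at x)"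
    unfolding gradient_def[abs_def]
    using pd[OF assms(3)] frechet_derivative_works
    by (intro has_derivative_sum has_derivative_scaleR_left) blast
  have 3: "(\<Sum>b'\<in>Basis. (\<Sum>b\<in>Basis. frechet_derivative (partial_deriv b f) (at x) b' *\<^sub>R b) \<bullet> b') = laplacian f x"
    unfolding laplacian_def partial_deriv_def[abs_def]
    by (rule sum.cong) (auto simp: inner_sum_left_Basis)
  show ?thesis
    by (rule has_grad_lapI[OF 1 2]) (use 3  in auto)
qed

section \<open>Interior maxima and the comparison principle\<close>

lemma has_grad_lap_local_max:
  fixes x :: "'a::euclidean_space"
  assumes f: "has_grad_lap f g L x" and max: "\<forall>\<^sub>F y in nhds x. f y \<le> f x"
  shows "g = 0" "L \<le> 0"
proof -
  obtain G DG where G: "\<forall>\<^sub>F y in nhds x. (f has_derivative (\<lambda>h. G y \<bullet> h)) (at y)"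
    "(G has_derivative DG) (at x)" "G x = g" "(\<Sum>b\<in>Basis. DG b \<bullet> b) = L"
    using f unfolding has_grad_lap_def by blast
  have df: "(f has_derivative (\<lambda>h. g \<bullet> h)) (at x)"
    using eventually_nhds_x_imp_x[OF G(1)] G(3) by simp
  obtain e where e: "e > 0" "\<And>y. dist y x < e \<Longrightarrow> f y \<le> f x"
    "\<And>y. dist y x < e \<Longrightarrow> (f has_derivative (\<lambda>h. G y \<bullet> h)) (at y)"
    using eventually_conj[OF max G(1)] unfolding eventually_nhds_metric by blast
  have "(\<lambda>h. g \<bullet> h) = (\<lambda>h. 0)"
    by (rule differential_zero_maxmin[OF _ open_ball[of x e] df]) (use e(1,2) in \<open>auto simp: dist_commute\<close>)
  from fun_cong[OF this, of g] have "g \<bullet> g = 0" .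
  then show g0: "g = 0" by simp
  \<comment> \<open>Second-order test along the line through \<open>x\<close> in direction
    \<open>b\<close>: the slope \<open>G \<bullet> b\<close> vanishes at \<open>x\<close>, so with
    positive derivative it would be positive just beyond \<open>x\<close>, and by the mean value
    theorem \<open>f\<close> would exceed its maximum.\<close>
  have "DG b \<bullet> b \<le> 0" if b: "b \<in> Basis" for b
  proof (rule ccontr)
    assume "\<not> DG b \<bullet> b \<le> 0"
    then have pos: "DG b \<bullet> b > 0" by simp
    have lin: "linear DG" using G(2) by (rule has_derivative_linear)
    let ?l = "\<lambda>t. x + t *\<^sub>R b"
    have l: "(?l has_derivative (\<lambda>t. t *\<^sub>R b)) (at t)" for t
      by (auto intro!: derivative_eq_intros)
    have "((\<lambda>t. G (?l t)) has_derivative (\<lambda>t. DG (t *\<^sub>R b))) (at 0)"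
      using has_derivative_compose[OF l, of G DG 0] G(2) by simp
    then have "((\<lambda>t. G (?l t) \<bullet> b) has_derivative (\<lambda>t. DG (t *\<^sub>R b) \<bullet> b)) (at 0)"
      by (rule has_derivative_inner_left)
    then have "((\<lambda>t. G (?l t) \<bullet> b) has_real_derivative DG b \<bullet> b) (at 0)"
      unfolding has_field_derivative_def by (rule back_subst[of "\<lambda>F. (_ has_derivative F) _"])
        (simp add: linear_cmul[OF lin] fun_eq_iff)
    from DERIV_pos_inc_right[OF this pos] obtain d where d: "d > 0"
      "\<And>h. h > 0 \<Longrightarrow> h < d \<Longrightarrow> G (?l h) \<bullet> b > 0"
      using G(3) g0 by auto
    define h where "h = min d e / 2"
    have h: "h > 0" "h < d" "h < e" using d(1) e(1) by (auto simp: h_def)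
    have "\<exists>t. t > 0 \<and> t < h \<and> f (?l h) - f (?l 0) = (h - 0) * (G (?l t) \<bullet> b)"
    proof (rule MVT2)
      fix t assume t: "0 \<le> t" "t \<le> h"
      have "dist (?l t) x < e" using t h b by (simp add: dist_norm)
      then have "(f has_derivative (\<lambda>h. G (?l t) \<bullet> h)) (at (?l t))" by (rule e)
      then have "((\<lambda>t. f (?l t)) has_derivative (\<lambda>s. G (?l t) \<bullet> (s *\<^sub>R b))) (at t)"
        by (rule has_derivative_compose[OF l])
      then show "((\<lambda>t. f (?l t)) has_real_derivative G (?l t) \<bullet> b) (at t)"
        unfolding has_field_derivative_def by (rule back_subst[of "\<lambda>F. (_ has_derivative F) _"])
          (simp add: fun_eq_iff)
    qed (use h in auto)
    then obtain t where "t > 0" "t < h" "f (?l h) - f x = h * (G (?l t) \<bullet> b)" by auto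
    moreover have "h * (G (?l t) \<bullet> b) > 0" using h d(2)[of t] calculation by simp
    ultimately have "f (?l h) > f x" by linarith
    moreover have "f (?l h) \<le> f x" by (rule e) (use h b in \<open>simp add: dist_norm\<close>)
    ultimately show False by simp
  qed
  then show "L \<le> 0" unfolding G(4)[symmetric] by (rule sum_nonpos)
qed

text \<open>At a positive interior maximum of \<open>u - w\<close> the gradients agree and \<Delta>u
  \<le> \<Delta>w. Hence \<open>super\<close> is asked only where \<open>u x > w x\<close> and only
  for equal gradients, which suits nonlinearities depending on the gradient. Staying in
  \<open>norm x \<ge> \<epsilon>\<close> keeps the singularity away and the set compact.\<close>

lemma comparison_principle:
  fixes u w :: "'a::euclidean_space \<Rightarrow> real"
  assumes "bounded \<Omega>" "open \<Omega>" "\<epsilon> > 0" "Ck_on 2 u \<Omega>" "continuous_on (closure \<Omega> - {0}) u"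
    and w: "\<And>x. x \<in> closure \<Omega> \<Longrightarrow> norm x \<ge> \<epsilon> \<Longrightarrow> isCont w x"
    and bd: "\<And>x. x \<in> frontier \<Omega> \<Longrightarrow> norm x \<ge> \<epsilon> \<Longrightarrow> u x \<le> w x"
      "\<And>x. x \<in> \<Omega> \<Longrightarrow> norm x = \<epsilon> \<Longrightarrow> u x \<le> w x"
    and super: "\<And>x. x \<in> \<Omega> \<Longrightarrow> norm x > \<epsilon> \<Longrightarrow> u x > w x \<Longrightarrow>
      \<exists>g L. has_grad_lap w g L x \<and> (gradient u x = g \<longrightarrow> laplacian u x > L)"
    and x: "x \<in> \<Omega>" "norm x \<ge> \<epsilon>"
  shows "u x \<le> w x"
proof (rule ccontr)
  assume "\<not> u x \<le> w x"
  let ?K = "closure \<Omega> \<inter> {x. norm x \<ge> \<epsilon>}"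
  have "compact ?K"
    using assms(1) by (intro compact_Int_closed)
      (auto simp: compact_closure closed_Collect_le continuous_on_norm_id)
  moreover have "continuous_on ?K (\<lambda>x. u x - w x)"
    using w assms(3)
    by (intro continuous_on_diff continuous_on_subset[OF assms(5)] continuous_at_imp_continuous_on) auto
  moreover have "x \<in> ?K" using x closure_subset by auto
  ultimately obtain y where y: "y \<in> ?K" "\<And>z. z \<in> ?K \<Longrightarrow> u z - w z \<le> u y - w y"
    using continuous_attains_sup[of ?K "\<lambda>x. u x - w x"] by blast
  have gt: "u y > w y" using y(2)[OF \<open>x \<in> ?K\<close>] \<open>\<not> u x \<le> w x\<close> by simp
  have "y \<notin> frontier \<Omega>" using bd(1)[of y] y gt by auto
  then have "y \<in> \<Omega>" using y assms(2) by (auto simp: frontier_def interior_open)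
  moreover have "norm y \<noteq> \<epsilon>" using bd(2)[of y] \<open>y \<in> \<Omega>\<close> gt by auto
  ultimately have *: "y \<in> \<Omega>" "norm y > \<epsilon>" using y by auto
  then obtain g L where gL: "has_grad_lap w g L y" "gradient u y = g \<longrightarrow> laplacian u y > L"
    using super gt by blast
  have "has_grad_lap (\<lambda>x. u x + (-1) * w x) (gradient u y + (-1) *\<^sub>R g) (laplacian u y + (-1) * L) y"
    by (intro has_grad_lap_add has_grad_lap_cmult gL has_grad_lap_C2[OF assms(4,2)] *)
  moreover have "open (\<Omega> \<inter> {x. norm x > \<epsilon>})"
    using assms(2) by (intro open_Int open_Collect_less continuous_intros)
  then have "\<forall>\<^sub>F z in nhds y. z \<in> \<Omega> \<inter> {x. norm x > \<epsilon>}"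
    by (rule eventually_nhds_in_open) (use * in auto)
  then have "\<forall>\<^sub>F z in nhds y. u z + (-1) * w z \<le> u y + (-1) * w y"
    by eventually_elim (use y(2) closure_subset in force)
  ultimately have "gradient u y + (-1) *\<^sub>R g = 0" "laplacian u y + (-1) * L \<le> 0"
    using has_grad_lap_local_max by blast+
  then show False using gL(2) by simp
qed

subsection \<open>The exterior ball and its Poisson kernel\<close>

text \<open>Differentiability of the gradient at 0 gives |G y - g| = O(|y|), and the mean value
  theorem on the segment from 0 to \<open>y\<close> turns this into a quadratic error. For a
  boundary graph it means lying above a paraboloid.\<close>

lemma has_grad_lap_quadratic_minorant:
  fixes f :: "'a::euclidean_space \<Rightarrow> real"
  assumes "has_grad_lap f g L 0"
  shows "\<exists>M. \<exists>d>0. \<forall>y. norm y < d \<longrightarrow> f y \<ge> f 0 + g \<bullet> y - M * (y \<bullet> y)"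
proof -
  obtain G DG where G: "\<forall>\<^sub>F y in nhds 0. (f has_derivative (\<lambda>h. G y \<bullet> h)) (at y)"
    "(G has_derivative DG) (at 0)" "G 0 = g"
    using assms unfolding has_grad_lap_def by blast
  obtain e where e: "e > 0" "\<And>y. norm y < e \<Longrightarrow> (f has_derivative (\<lambda>h. G y \<bullet> h)) (at y)"
    using G(1) unfolding eventually_nhds_metric by auto
  obtain d where d: "d > 0" "\<And>y. norm y < d \<Longrightarrow> norm (G y - g - DG y) \<le> norm y"
    using G(2,3) unfolding has_derivative_at_alt by (metis diff_zero mult_1 zero_less_one)
  obtain K where K: "\<And>y. norm (DG y) \<le> norm y * K"
    using bounded_linear.bounded[OF has_derivative_bounded_linear[OF G(2)]] by blast
  have bound: "norm (G y - g) \<le> (1 + \<bar>K\<bar>) * norm y" if "norm y < d" for y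
  proof -
    have "norm (G y - g) \<le> norm (G y - g - DG y) + norm (DG y)"
      using norm_triangle_ineq[of "G y - g - DG y" "DG y"] by simp
    also have "\<dots> \<le> norm y + norm y * \<bar>K\<bar>"
      using d(2)[OF that] K[of y] by (smt (verit) mult_left_mono norm_ge_zero)
    finally show ?thesis by (simp add: algebra_simps)
  qed
  have "f y \<ge> f 0 + g \<bullet> y - (1 + \<bar>K\<bar>) * (y \<bullet> y)" if y: "norm y < min d e" for y
  proof -
    let ?l = "\<lambda>t. t *\<^sub>R y"
    have l: "(?l has_derivative (\<lambda>t. t *\<^sub>R y)) (at t)" for t
      by (auto intro!: derivative_eq_intros)
    have small: "norm (?l t) \<le> norm y" if "0 \<le> t" "t \<le> 1" for t
      using that by (simp add: mult_left_le_one_le)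
    have "\<exists>t. t > 0 \<and> t < 1 \<and> f (?l 1) - f (?l 0) = (1 - 0) * (G (?l t) \<bullet> y)"
    proof (rule MVT2)
      fix t :: real assume t: "0 \<le> t" "t \<le> 1"
      have "(f has_derivative (\<lambda>h. G (?l t) \<bullet> h)) (at (?l t))"
        by (rule e) (use small[OF t] y in simp)
      then have "((\<lambda>t. f (?l t)) has_derivative (\<lambda>s. G (?l t) \<bullet> (s *\<^sub>R y))) (at t)"
        by (rule has_derivative_compose[OF l])
      then show "((\<lambda>t. f (?l t)) has_real_derivative G (?l t) \<bullet> y) (at t)"
        unfolding has_field_derivative_def by (rule back_subst[of "\<lambda>F. (_ has_derivative F) _"])
          (simp add: fun_eq_iff)
    qed auto
    then obtain t where t: "t > 0" "t < 1" "f y - f 0 = G (?l t) \<bullet> y" by auto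
    have "\<bar>(G (?l t) - g) \<bullet> y\<bar> \<le> norm (G (?l t) - g) * norm y"
      by (rule Cauchy_Schwarz_ineq2)
    also have "\<dots> \<le> ((1 + \<bar>K\<bar>) * norm (?l t)) * norm y"
      by (intro mult_right_mono bound) (use small[of t] t y in auto)
    also have "\<dots> \<le> ((1 + \<bar>K\<bar>) * norm y) * norm y"
      by (intro mult_right_mono mult_left_mono small) (use t in auto)
    also have "\<dots> = (1 + \<bar>K\<bar>) * (y \<bullet> y)"
      by (simp add: dot_square_norm power2_eq_square mult.assoc)
    finally have "(G (?l t) - g) \<bullet> y \<ge> - ((1 + \<bar>K\<bar>) * (y \<bullet> y))" by linarith
    then show ?thesis using t(3) by (simp add: inner_diff_left)
  qed
  then show ?thesis using d(1) e(1) by (intro exI[of _ "1 + \<bar>K\<bar>"] exI[of _ "min d e"]) auto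
qed

text \<open>
  Positive exactly outside the closed ball that has \<open>-c\<close> and \<open>0\<close> as antipodal points; multiplied by
  \<open>|x|\<^sup>-\<^sup>N\<close> it is, up to a factor, the Poisson kernel \<open>P\<close> of the exterior of that ball.
\<close>

definition ext_fun :: "'a::euclidean_space \<Rightarrow> 'a \<Rightarrow> real" where
  "ext_fun c x = x \<bullet> x + x \<bullet> c"

text \<open>Near 0 the graph lies above a paraboloid, so points of \<Omega> satisfy x \<bullet> v +
  |M| |x|^2 > 0 with \<open>v\<close> an inner normal. Enlarging the coefficient to \<open>m\<close>
  makes this global, and division by \<open>m\<close> gives the exterior ball with
  \<open>c = v /\<^sub>R m\<close>.\<close>

lemma exterior_ball:
  fixes \<Omega> :: "'a::euclidean_space set"
  assumes dom: "bounded_Ck_domain 2 \<Omega>" and 0: "0 \<in> frontier \<Omega>"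
  shows "\<exists>c. c \<noteq> 0 \<and> (\<forall>x\<in>\<Omega>. ext_fun c x > 0)"
proof -
  have op: "open \<Omega>" using dom by (simp add: bounded_Ck_domain_def)
  obtain r e \<gamma> where r: "r > 0" and e: "norm e = 1" and \<gamma>: "Ck_on 2 (\<gamma> :: 'a \<Rightarrow> real) UNIV"
    and eq: "\<Omega> \<inter> ball 0 r = {x \<in> ball 0 r. x \<bullet> e > \<gamma> (x - (x \<bullet> e) *\<^sub>R e)}"
    using dom 0 unfolding bounded_Ck_domain_def Ck_boundary_def by blast
  let ?pr = "\<lambda>x. x - (x \<bullet> e) *\<^sub>R e"
  have hl: "has_grad_lap \<gamma> (gradient \<gamma> x) (laplacian \<gamma> x) x" for x
    by (rule has_grad_lap_C2[OF \<gamma>]) auto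
  have "0 \<notin> \<Omega>" using 0 op by (simp add: frontier_def interior_open)
  then have "\<gamma> 0 \<ge> 0" using eq r by fastforce
  \<comment> \<open>Otherwise, by continuity, a whole neighbourhood of 0 lies below the graph and
    misses \<Omega>, contradicting that 0 is a boundary point.\<close>
  moreover have "\<gamma> 0 \<le> 0"
  proof (rule ccontr)
    assume "\<not> \<gamma> 0 \<le> 0"
    have "isCont \<gamma> 0" using hl by (rule has_grad_lap_continuous)
    then have "isCont (\<lambda>x. \<gamma> (?pr x) - x \<bullet> e) 0"
      by (auto intro!: continuous_intros isCont_o2[of 0 ?pr \<gamma>])
    then have "((\<lambda>x. \<gamma> (?pr x) - x \<bullet> e) \<longlongrightarrow> \<gamma> 0) (nhds 0)"
      using tendsto_at_iff_tendsto_nhds[of "\<lambda>x. \<gamma> (?pr x) - x \<bullet> e" 0] by (simp add: isCont_def)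
    then have "\<forall>\<^sub>F x in nhds 0. \<gamma> (?pr x) - x \<bullet> e > 0"
      using \<open>\<not> \<gamma> 0 \<le> 0\<close> by (intro order_tendstoD(1)) auto
    moreover have "\<forall>\<^sub>F x in nhds 0. x \<in> ball 0 r"
      by (rule eventually_nhds_in_open) (use r in auto)
    ultimately have "\<forall>\<^sub>F x in nhds 0. x \<notin> \<Omega>"
    proof eventually_elim
      case (elim x)
      then have "x \<notin> {x \<in> ball 0 r. x \<bullet> e > \<gamma> (?pr x)}" by simp
      with elim(2) show ?case unfolding eq[symmetric] by blast
    qed
    then have "\<exists>S. open S \<and> 0 \<in> S \<and> S \<inter> \<Omega> = {}" unfolding eventually_nhds by blast
    then have "0 \<notin> closure \<Omega>" using closure_iff_nhds_not_empty by blast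
    with 0 show False by (simp add: frontier_def)
  qed
  ultimately have \<gamma>0: "\<gamma> 0 = 0" by simp
  \<comment> \<open>Since \<open>\<gamma>\<close> is evaluated only at vectors orthogonal to
    \<open>e\<close>, its gradient enters through its tangential part \<open>a\<close>. The vector
    \<open>v\<close> is the unnormalised inner normal, nonzero because
    \<open>v \<bullet> e = 1\<close>.\<close>
  define a where "a = gradient \<gamma> 0 - (gradient \<gamma> 0 \<bullet> e) *\<^sub>R e"
  define v where "v = e - a"
  have ee: "e \<bullet> e = 1" using e by (simp add: dot_square_norm)
  then have "v \<bullet> e = 1" by (simp add: v_def a_def inner_diff_left)
  then have v: "v \<noteq> 0" by auto
  obtain M d where M: "d > 0" "\<And>y. norm y < d \<Longrightarrow> \<gamma> y \<ge> gradient \<gamma> 0 \<bullet> y - M * (y \<bullet> y)"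
    using has_grad_lap_quadratic_minorant[OF hl] \<gamma>0 by auto
  define d' where "d' = min d r"
  have d': "d' > 0" using M r by (simp add: d'_def)
  have near: "x \<bullet> v + \<bar>M\<bar> * (x \<bullet> x) > 0" if x: "x \<in> \<Omega>" "norm x < d'" for x
  proof -
    have pp: "?pr x \<bullet> ?pr x = x \<bullet> x - (x \<bullet> e)\<^sup>2"
      using ee by (simp add: inner_diff_left inner_diff_right inner_commute power2_eq_square algebra_simps)
    then have le: "?pr x \<bullet> ?pr x \<le> x \<bullet> x" by simp
    then have "norm (?pr x) \<le> norm x" by (simp only: norm_le)
    then have "\<gamma> (?pr x) \<ge> gradient \<gamma> 0 \<bullet> ?pr x - M * (?pr x \<bullet> ?pr x)"
      by (intro M) (use x in \<open>auto simp: d'_def\<close>)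
    moreover have "M * (?pr x \<bullet> ?pr x) \<le> \<bar>M\<bar> * (x \<bullet> x)"
      by (intro mult_mono le) auto
    moreover have "gradient \<gamma> 0 \<bullet> ?pr x = x \<bullet> a"
      by (simp add: a_def inner_diff_left inner_diff_right inner_commute)
    moreover have "x \<bullet> e > \<gamma> (?pr x)"
    proof -
      have "x \<in> \<Omega> \<inter> ball 0 r" using x by (simp add: d'_def)
      then show ?thesis unfolding eq by blast
    qed
    ultimately show ?thesis by (simp add: v_def inner_diff_right)
  qed
  \<comment> \<open>The first summand serves near 0; the second makes m |x|^2 beat |x| |v| once |x|
    \<ge> d', with 1 added for strictness.\<close>
  define m where "m = \<bar>M\<bar> + norm v / d' + 1"
  have m: "m > 0" "m \<ge> \<bar>M\<bar>" "norm v < m * d'"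
    using d' by (auto simp: m_def algebra_simps add_pos_nonneg)
  have "x \<bullet> v + m * (x \<bullet> x) > 0" if x: "x \<in> \<Omega>" for x
  proof (cases "norm x < d'")
    case True
    have "\<bar>M\<bar> * (x \<bullet> x) \<le> m * (x \<bullet> x)" by (intro mult_right_mono m) auto
    with near[OF x True] show ?thesis by linarith
  next
    case False
    have "- (x \<bullet> v) \<le> norm x * norm v" using Cauchy_Schwarz_ineq2[of x v] by linarith
    also have "\<dots> < norm x * (m * d')" using m(3) False d' by (intro mult_strict_left_mono) auto
    also have "\<dots> \<le> norm x * (m * norm x)" using False m by (intro mult_left_mono) auto
    also have "\<dots> = m * (x \<bullet> x)" by (simp add: dot_square_norm power2_eq_square)
    finally show ?thesis by simp
  qed
  then have "ext_fun (v /\<^sub>R m) x > 0" if "x \<in> \<Omega>" for x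
    using that[THEN \<open>\<And>x. x \<in> \<Omega> \<Longrightarrow> _\<close>] m(1) by (simp add: ext_fun_def field_simps)
  then show ?thesis using v m(1) by (intro exI[of _ "v /\<^sub>R m"]) auto
qed

section \<open>Gradients and Laplacians of kernels built from \<open>ext_fun\<close>\<close>

lemma has_grad_lap_ext_fun:
  fixes x :: "'a::euclidean_space"
  shows "has_grad_lap (ext_fun c) (2 *\<^sub>R x + c) (2 * real DIM('a)) x"
  unfolding ext_fun_def[abs_def]
  using has_grad_lap_add[OF has_grad_lap_inner_self has_grad_lap_inner, of c x] by simp

text \<open>The vector on the left is the gradient of \<open>ext_fun c\<close>, whose homogeneous
  parts have degrees 2 and 1, so the quadratic part counts twice. This evaluates the mixed term of
  the product rule with a power of the norm.\<close>

lemma ext_fun_Euler: "(2 *\<^sub>R x + c) \<bullet> x = ext_fun c x + (norm x)\<^sup>2"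
  by (simp add: ext_fun_def power2_norm_eq_inner inner_add_left inner_commute[of c x])

lemma ext_fun_grad_square: "(2 *\<^sub>R x + c) \<bullet> (2 *\<^sub>R x + c) = 4 * ext_fun c x + c \<bullet> c"
  by (simp add: ext_fun_def inner_add_left inner_add_right inner_commute[of c x])

lemma norm_powr_shift:
  assumes "x \<noteq> 0"
  shows "norm x powr \<beta> = (norm x)\<^sup>2 * norm x powr (\<beta> - 2)"
proof -
  have "(norm x)\<^sup>2 = norm x powr 2" using assms by simp
  then show ?thesis by (simp add: powr_add[symmetric] del: powr_numeral)
qed

text \<open>Product rule with the Euler identity. Both coefficients of the Laplacian vanish exactly
  for \<beta> = -N, the exponent of the Poisson kernel.\<close>

lemma has_grad_lap_ext_fun_powr:
  fixes x :: "'a::euclidean_space"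
  assumes "x \<noteq> 0"
  shows "has_grad_lap (\<lambda>x. ext_fun c x * norm x powr \<beta>)
     (norm x powr \<beta> *\<^sub>R (2 *\<^sub>R x + c) + (\<beta> * ext_fun c x * norm x powr (\<beta> - 2)) *\<^sub>R x)
     ((2 * real DIM('a) + 2 * \<beta>) * norm x powr \<beta>
        + \<beta> * (\<beta> + real DIM('a)) * ext_fun c x * norm x powr (\<beta> - 2)) x"
proof -
  let ?s = "ext_fun c x" and ?N = "real DIM('a)" and ?t = "norm x powr (\<beta> - 2)"
  note * = has_grad_lap_mult[OF has_grad_lap_ext_fun has_grad_lap_norm_powr[OF assms], of c \<beta>]
  have "?s *\<^sub>R (\<beta> * ?t) *\<^sub>R x + norm x powr \<beta> *\<^sub>R (2 *\<^sub>R x + c)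
      = norm x powr \<beta> *\<^sub>R (2 *\<^sub>R x + c) + (\<beta> * ?s * ?t) *\<^sub>R x"
    by (simp add: mult_ac)
  moreover have "?s * (\<beta> * (\<beta> + ?N - 2) * ?t) + norm x powr \<beta> * (2 * ?N)
      + 2 * ((2 *\<^sub>R x + c) \<bullet> ((\<beta> * ?t) *\<^sub>R x))
      = (2 * ?N + 2 * \<beta>) * norm x powr \<beta> + \<beta> * (\<beta> + ?N) * ?s * ?t"
    unfolding inner_scaleR_right ext_fun_Euler norm_powr_shift[OF assms, of \<beta>]
    by (simp add: algebra_simps)
  ultimately show ?thesis using * by metis
qed

lemma has_grad_lap_poisson:
  fixes x :: "'a::euclidean_space"
  assumes "x \<noteq> 0"
  shows "has_grad_lap (\<lambda>x. ext_fun c x * norm x powr (- real DIM('a)))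
     (norm x powr (- real DIM('a)) *\<^sub>R (2 *\<^sub>R x + c)
        - (real DIM('a) * ext_fun c x * norm x powr (- real DIM('a) - 2)) *\<^sub>R x) 0 x"
  using has_grad_lap_ext_fun_powr[OF assms, of c "- real DIM('a)"] by simp

text \<open>The exponent \<open>m\<close> is the one for which every term still containing
  \<open>ext_fun\<close> cancels: their coefficients are 4(N + m + 2) and m(m + N + 2). What remains
  is the constant part of the squared gradient of \<open>ext_fun\<close>.\<close>

lemma has_grad_lap_ext_fun_square_powr:
  fixes x :: "'a::euclidean_space"
  assumes "x \<noteq> 0"
  defines "m \<equiv> - real DIM('a) - 2"
  shows "has_grad_lap (\<lambda>x. ext_fun c x * (ext_fun c x * norm x powr m))
     ((2 * ext_fun c x * norm x powr m) *\<^sub>R (2 *\<^sub>R x + c) + (m * (ext_fun c x)\<^sup>2 * norm x powr (m - 2)) *\<^sub>R x)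
     (2 * (c \<bullet> c) * norm x powr m) x"
proof -
  let ?s = "ext_fun c x" and ?N = "real DIM('a)" and ?t = "norm x powr (m - 2)"
  let ?G = "norm x powr m *\<^sub>R (2 *\<^sub>R x + c) + (m * ?s * ?t) *\<^sub>R x"
  note * = has_grad_lap_mult[OF has_grad_lap_ext_fun has_grad_lap_ext_fun_powr[OF assms(1)], of c c m]
  have inner: "(2 *\<^sub>R x + c) \<bullet> ?G = norm x powr m * (4 * ?s + c \<bullet> c) + m * ?s * ?t * (?s + (norm x)\<^sup>2)"
    by (simp only: inner_add_right[of _ "norm x powr m *\<^sub>R (2 *\<^sub>R x + c)"] inner_scaleR_right
        ext_fun_Euler ext_fun_grad_square)
  have "?s *\<^sub>R ?G + (?s * norm x powr m) *\<^sub>R (2 *\<^sub>R x + c)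
      = (2 * ?s * norm x powr m) *\<^sub>R (2 *\<^sub>R x + c) + (m * ?s\<^sup>2 * ?t) *\<^sub>R x"
    by (simp add: algebra_simps power2_eq_square flip: scaleR_add_left)
  moreover have "?s * ((2 * ?N + 2 * m) * norm x powr m + m * (m + ?N) * ?s * ?t)
      + ?s * norm x powr m * (2 * ?N) + 2 * ((2 *\<^sub>R x + c) \<bullet> ?G) = 2 * (c \<bullet> c) * norm x powr m"
    unfolding inner unfolding norm_powr_shift[OF assms(1), of m]
    by (simp add: m_def algebra_simps power2_eq_square)
  ultimately show ?thesis using * by metis
qed

text \<open>
  On \<open>|x| = \<epsilon>\<close> the function \<open>\<epsilon> layer\<close> dominates \<open>P\<close>, but for \<open>\<epsilon> \<rightarrow> 0\<close> it vanishes off the origin. The second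
  term, whose Laplacian is exactly a multiple of \<open>|x|\<^sup>-\<^sup>N\<^sup>-\<^sup>2\<close>, makes it superharmonic close to the sphere,
  where \<open>P\<close> vanishes and the nonlinearity is too weak to help.
\<close>

definition layer :: "'a::euclidean_space \<Rightarrow> real \<Rightarrow> 'a \<Rightarrow> real" where
  "layer c \<Lambda> x = 2 * (ext_fun c x * norm x powr (- real DIM('a) - 1)) +
     (- 1 / \<Lambda>) * (ext_fun c x * (ext_fun c x * norm x powr (- real DIM('a) - 2)))"

text \<open>The subtracted square consumes at most half of the first term because
  \<open>ext_fun c x \<le> \<Lambda> * norm x\<close>. On |x| = \<epsilon> this is the domination of
  \<open>P\<close> by \<epsilon> times the layer.\<close>

lemma layer_ge:
  fixes x :: "'a::euclidean_space"
  assumes "x \<noteq> 0" "\<Lambda> > 0" "0 \<le> ext_fun c x" "ext_fun c x \<le> \<Lambda> * norm x"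
  shows "layer c \<Lambda> x \<ge> ext_fun c x * norm x powr (- real DIM('a) - 1)"
proof -
  let ?s = "ext_fun c x" and ?t = "norm x powr (- real DIM('a) - 2)"
  have t: "norm x powr (- real DIM('a) - 1) = norm x * ?t"
    by (simp add: powr_mult_base minus_diff_commute)
  have "?s * (?s * ?t) \<le> ?s * ((\<Lambda> * norm x) * ?t)"
    by (intro mult_left_mono mult_right_mono assms) auto
  then have "(1 / \<Lambda>) * (?s * (?s * ?t)) \<le> (1 / \<Lambda>) * (?s * ((\<Lambda> * norm x) * ?t))"
    by (rule mult_left_mono) (use assms(2) in simp)
  also have "\<dots> = ?s * (norm x * ?t)" using assms(2) by simp
  finally show ?thesis unfolding layer_def t by (simp add: mult_ac)
qed

text \<open>The first term of the layer contributes the positive part proportional to ext_fun / |x|,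
  plus a negative part that is discarded; the square contributes the fixed negative part. So the
  layer is superharmonic where ext_fun / |x| is small.\<close>

lemma has_grad_lap_layer:
  fixes x :: "'a::euclidean_space"
  assumes x: "x \<noteq> 0" and \<Lambda>: "\<Lambda> > 0"
    and s: "0 \<le> ext_fun c x" "ext_fun c x \<le> \<Lambda> * norm x" and g: "norm (2 *\<^sub>R x + c) \<le> \<Lambda>"
  defines "N \<equiv> real DIM('a)"
  shows "\<exists>g L. has_grad_lap (layer c \<Lambda>) g L x \<and> norm g \<le> (3 * N + 8) * \<Lambda> * norm x powr (- N - 1) \<and>
    L \<le> norm x powr (- N - 2) * (2 * (N + 1) * (ext_fun c x / norm x) - 2 * (c \<bullet> c) / \<Lambda>)"
proof -
  let ?s = "ext_fun c x" and ?r = "norm x" and ?v = "2 *\<^sub>R x + c"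
  \<comment> \<open>The lowest power that occurs; relative to it all others become natural powers of
    \<open>?r\<close>.\<close>
  let ?t = "norm x powr (- N - 4)"
  have r: "?r > 0" using x by simp
  have N: "N \<ge> 0" by (simp add: N_def)
  have p3: "?r powr (- N - 3) = ?r * ?t" and p2: "?r powr (- N - 2) = ?r ^ 2 * ?t"
    and p1: "?r powr (- N - 1) = ?r ^ 3 * ?t"
    using r by (simp_all add: powr_mult_base power2_eq_square power3_eq_cube mult.assoc minus_diff_commute)
  have t: "?t > 0" using r by simp
  define g1 where "g1 = (?r ^ 3 * ?t) *\<^sub>R ?v + (- (N + 1) * ?s * (?r * ?t)) *\<^sub>R x"
  define g2 where "g2 = (2 * ?s * (?r ^ 2 * ?t)) *\<^sub>R ?v + ((- N - 2) * ?s\<^sup>2 * ?t) *\<^sub>R x"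
  define L1 where "L1 = - 2 * (?r ^ 3 * ?t) + (N + 1) * ?s * (?r * ?t)"
  define L2 where "L2 = 2 * (c \<bullet> c) * (?r ^ 2 * ?t)"
  have 1: "has_grad_lap (\<lambda>x. ext_fun c x * norm x powr (- N - 1)) g1 L1 x"
  proof -
    have "- N - 1 - 2 = - N - 3" by simp
    note * = has_grad_lap_ext_fun_powr[OF x, of c "- N - 1", folded N_def, unfolded this p1 p3]
    have "g1 = (?r ^ 3 * ?t) *\<^sub>R ?v + ((- N - 1) * ?s * (?r * ?t)) *\<^sub>R x"
      by (simp add: g1_def)
    moreover have "L1 = (2 * N + 2 * (- N - 1)) * (?r ^ 3 * ?t) + (- N - 1) * (- N - 1 + N) * ?s * (?r * ?t)"
      by (simp add: L1_def)
    ultimately show ?thesis using * unfolding p1 by metis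
  qed
  have 2: "has_grad_lap (\<lambda>x. ext_fun c x * (ext_fun c x * norm x powr (- N - 2))) g2 L2 x"
    using has_grad_lap_ext_fun_square_powr[OF x, of c, folded N_def]
    by (simp add: g2_def L2_def p2 minus_diff_commute)
  have "has_grad_lap (layer c \<Lambda>) (2 *\<^sub>R g1 + (- 1 / \<Lambda>) *\<^sub>R g2) (2 * L1 + (- 1 / \<Lambda>) * L2) x"
    unfolding layer_def[abs_def] N_def[symmetric]
    by (intro has_grad_lap_add has_grad_lap_cmult 1 2)
  moreover have "norm (2 *\<^sub>R g1 + (- 1 / \<Lambda>) *\<^sub>R g2) \<le> (3 * N + 8) * \<Lambda> * ?r powr (- N - 1)"
  proof -
    have "norm g1 \<le> ?r ^ 3 * ?t * norm ?v + (N + 1) * ?s * (?r * ?t) * ?r"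
      unfolding g1_def
      by (rule norm_triangle_le) (use s(1) N t in \<open>simp add: abs_mult add.commute\<close>)
    also have "\<dots> \<le> ?r ^ 3 * ?t * \<Lambda> + (N + 1) * (\<Lambda> * ?r) * (?r * ?t) * ?r"
      by (intro add_mono mult_left_mono mult_right_mono g s) (use N t in auto)
    finally have b1: "norm g1 \<le> (N + 2) * \<Lambda> * (?r ^ 3 * ?t)"
      by (simp add: algebra_simps power3_eq_cube)
    have "norm g2 \<le> 2 * ?s * (?r ^ 2 * ?t) * norm ?v + (N + 2) * ?s\<^sup>2 * ?t * ?r"
      unfolding g2_def
      by (rule norm_triangle_le) (use s(1) N t in \<open>simp add: abs_mult add.commute\<close>)
    also have "\<dots> \<le> 2 * (\<Lambda> * ?r) * (?r ^ 2 * ?t) * \<Lambda> + (N + 2) * (\<Lambda> * ?r)\<^sup>2 * ?t * ?r"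
      by (intro add_mono mult_mono mult_left_mono mult_right_mono power_mono g s) (use N t \<Lambda> s in auto)
    finally have b2: "norm g2 \<le> (N + 4) * \<Lambda> * \<Lambda> * (?r ^ 3 * ?t)"
      by (simp add: algebra_simps power3_eq_cube power2_eq_square)
    have "norm (2 *\<^sub>R g1 + (- 1 / \<Lambda>) *\<^sub>R g2) \<le> 2 * norm g1 + (1 / \<Lambda>) * norm g2"
      by (rule norm_triangle_le) (use \<Lambda> in simp)
    also have "\<dots> \<le> 2 * ((N + 2) * \<Lambda> * (?r ^ 3 * ?t)) + (1 / \<Lambda>) * ((N + 4) * \<Lambda> * \<Lambda> * (?r ^ 3 * ?t))"
      by (intro add_mono mult_left_mono b1 b2) (use \<Lambda> in auto)
    also have "\<dots> = (3 * N + 8) * \<Lambda> * (?r ^ 3 * ?t)"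
      using \<Lambda> by (simp add: field_simps)
    finally show ?thesis unfolding p1 .
  qed
  moreover have "2 * L1 + (- 1 / \<Lambda>) * L2
      \<le> ?r powr (- N - 2) * (2 * (N + 1) * (?s / ?r) - 2 * (c \<bullet> c) / \<Lambda>)"
  proof -
    have eq: "?r powr (- N - 2) * (2 * (N + 1) * (?s / ?r) - 2 * (c \<bullet> c) / \<Lambda>)
        = 2 * (N + 1) * ?s * (?r * ?t) + (- 1 / \<Lambda>) * L2"
      unfolding p2 L2_def using r \<Lambda> by (simp add: field_simps power2_eq_square)
    have "0 \<le> 4 * (?r ^ 3 * ?t)" using t by simp
    then show ?thesis unfolding eq L1_def by (simp add: algebra_simps)
  qed
  ultimately show ?thesis by blast
qed

text \<open>After extracting |x|^(-N), the squared length of the remaining vector is |c|^2 - 2(N-2)s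
  + N(N-2)(s/|x|)^2 with s = \<open>ext_fun c x\<close>. The last term is nonnegative and s \<le>
  \<Lambda>|x|, so for small |x| at least |c|^2/4 is left.\<close>

lemma poisson_grad_lower:
  fixes x :: "'a::euclidean_space"
  assumes x: "x \<noteq> 0" and \<Lambda>: "\<Lambda> > 0"
    and s: "0 \<le> ext_fun c x" "ext_fun c x \<le> \<Lambda> * norm x"
  defines "N \<equiv> real DIM('a)"
  assumes N: "N \<ge> 2" and r: "8 * N * \<Lambda> * norm x \<le> 3 * (c \<bullet> c)"
  shows "norm (norm x powr (- N) *\<^sub>R (2 *\<^sub>R x + c) - (N * ext_fun c x * norm x powr (- N - 2)) *\<^sub>R x)
    \<ge> norm c / 2 * norm x powr (- N)"
proof -
  let ?s = "ext_fun c x" and ?r = "norm x" and ?v = "2 *\<^sub>R x + c"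
  define h where "h = ?v - (N * ?s / ?r\<^sup>2) *\<^sub>R x"
  have r0: "?r > 0" using x by simp
  have eq: "norm x powr (- N) *\<^sub>R ?v - (N * ?s * norm x powr (- N - 2)) *\<^sub>R x = norm x powr (- N) *\<^sub>R h"
    unfolding h_def norm_powr_shift[OF x, of "- N"] using r0 by (simp add: algebra_simps)
  have "h \<bullet> h = ?v \<bullet> ?v - 2 * (N * ?s / ?r\<^sup>2) * (?v \<bullet> x) + (N * ?s / ?r\<^sup>2)\<^sup>2 * (x \<bullet> x)"
    unfolding h_def
    by (simp only: inner_diff_left inner_diff_right inner_scaleR_left inner_scaleR_right inner_commute[of x ?v])
       (simp add: algebra_simps power2_eq_square)
  also have "\<dots> = (c \<bullet> c) - 2 * (N - 2) * ?s + N * (N - 2) * (?s / ?r)\<^sup>2"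
    unfolding ext_fun_grad_square ext_fun_Euler unfolding power2_norm_eq_inner[symmetric]
    using r0 by (simp add: field_simps power2_eq_square)
  also have "\<dots> \<ge> (c \<bullet> c) - 2 * N * (\<Lambda> * ?r)"
  proof -
    have "(N - 2) * ?s \<le> N * (\<Lambda> * ?r)" using s N by (intro mult_mono) auto
    moreover have "0 \<le> N * (N - 2) * (?s / ?r)\<^sup>2" using N by simp
    ultimately show ?thesis by linarith
  qed
  finally have "h \<bullet> h \<ge> (c \<bullet> c) / 4" using r by simp
  then have "(norm c / 2)\<^sup>2 \<le> (norm h)\<^sup>2"
    by (simp add: power2_norm_eq_inner power_divide)
  then have "norm c / 2 \<le> norm h" by (rule power2_le_imp_le) simp
  then have "norm c / 2 * ?r powr (- N) \<le> norm h * ?r powr (- N)" by (rule mult_right_mono) simp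
  then show ?thesis unfolding eq by (simp add: mult.commute)
qed

lemma rpow_pos: "s > 0 \<Longrightarrow> rpow s q = s powr q"
  by (simp add: rpow_def)

lemma rpow_nonneg: "rpow s q \<ge> 0"
  by (simp add: rpow_def)

lemma rpow_mono: "0 < s \<Longrightarrow> s \<le> t \<Longrightarrow> 0 \<le> p \<Longrightarrow> rpow s p \<le> rpow t p"
  by (simp add: rpow_def powr_mono2)

subsection \<open>Subsolutions with a boundary singularity\<close>

text \<open>Common setting for both cases: a dropped factor is encoded by the exponent 0, for which
  \<open>rpow\<close> is 1. The boundary enters only through the exterior ball given by
  \<open>c\<close>.\<close>

locale boundary_subsolution =
  fixes \<Omega> :: "'a::euclidean_space set" and u :: "'a \<Rightarrow> real" and p q R :: real and c :: 'a and N :: real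
  defines "N \<equiv> real DIM('a)"
  assumes op: "open \<Omega>" and sub_ball: "\<Omega> \<subseteq> ball 0 R" and R: "R \<ge> 1"
    and c: "c \<noteq> 0" and ext: "\<And>x. x \<in> \<Omega> \<Longrightarrow> ext_fun c x > 0"
    and C2: "Ck_on 2 u \<Omega>" and cont: "continuous_on (closure \<Omega> - {0}) u"
    and bd0: "\<And>x. x \<in> frontier \<Omega> \<Longrightarrow> x \<noteq> 0 \<Longrightarrow> u x = 0"
    and N2: "N \<ge> 2" and p: "p \<ge> 0" and q: "q \<ge> 0" and crit: "N * (p + q - 1) \<ge> p + 1"
    and subsol: "\<And>x. x \<in> \<Omega> \<Longrightarrow> laplacian u x \<ge> rpow (u x) p * rpow (norm (gradient u x)) q"
begin

lemma bounded: "bounded \<Omega>"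
  using bounded_subset[OF bounded_ball sub_ball] .

lemma closure_norm: "x \<in> closure \<Omega> \<Longrightarrow> norm x \<le> R"
  using closure_minimal[of \<Omega> "cball 0 R"] sub_ball by fastforce

lemma closure_inner: "x \<in> closure \<Omega> \<Longrightarrow> x \<bullet> x \<le> R\<^sup>2"
  using closure_norm[of x] by (metis norm_ge_zero power2_norm_eq_inner power_mono)

lemma closure_ext: "x \<in> closure \<Omega> \<Longrightarrow> ext_fun c x \<ge> 0"
proof -
  have "closed {x. ext_fun c x \<ge> 0}"
    unfolding ext_fun_def by (intro closed_Collect_le continuous_intros)
  then show "x \<in> closure \<Omega> \<Longrightarrow> ext_fun c x \<ge> 0"
    using closure_minimal[of \<Omega> "{x. ext_fun c x \<ge> 0}"] ext by (force simp: less_imp_le)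
qed

lemma nonzero: "x \<in> \<Omega> \<Longrightarrow> x \<noteq> 0"
  using ext[of 0] by (auto simp: ext_fun_def)

lemma pq: "p + q - 1 > 0"
  using crit p N2 by (smt (verit) mult_nonneg_nonpos)

text \<open>On the outer boundary \<open>u = 0 \<le> w\<close>. Inside, either \<open>L < 0\<close>
  while the right-hand side for \<open>u\<close> is nonnegative, or \<open>w\<close> is a strict
  supersolution and the nonlinearity increases from \<open>w\<close> to \<open>u\<close> at the
  common gradient.\<close>

lemma supersolution_bound:
  assumes "\<epsilon> > 0"
    and w: "\<And>x. x \<in> closure \<Omega> \<Longrightarrow> norm x \<ge> \<epsilon> \<Longrightarrow> isCont w x \<and> w x \<ge> 0"
    and inner: "\<And>x. x \<in> \<Omega> \<Longrightarrow> norm x = \<epsilon> \<Longrightarrow> u x \<le> w x"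
    and super: "\<And>x. x \<in> \<Omega> \<Longrightarrow> norm x > \<epsilon> \<Longrightarrow>
      \<exists>g L. has_grad_lap w g L x \<and> (L < 0 \<or> w x > 0 \<and> L < rpow (w x) p * rpow (norm g) q)"
    and x: "x \<in> \<Omega>" "norm x \<ge> \<epsilon>"
  shows "u x \<le> w x"
proof (rule comparison_principle[OF bounded op assms(1) C2 cont])
  show "isCont w x" if "x \<in> closure \<Omega>" "norm x \<ge> \<epsilon>" for x using w that by blast
  show "u x \<le> w x" if "x \<in> frontier \<Omega>" "norm x \<ge> \<epsilon>" for x
  proof -
    have "x \<noteq> 0" using that assms(1) by auto
    then show ?thesis using bd0[of x] w[of x] that by (simp add: frontier_def)
  qed
  show "u x \<le> w x" if "x \<in> \<Omega>" "norm x = \<epsilon>" for x using inner that by blast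
next
  fix x assume x: "x \<in> \<Omega>" "norm x > \<epsilon>" "u x > w x"
  obtain g L where gL: "has_grad_lap w g L x"
    "L < 0 \<or> w x > 0 \<and> L < rpow (w x) p * rpow (norm g) q"
    using super x by blast
  have "laplacian u x > L" if "gradient u x = g"
    using gL(2)
  proof
    assume "L < 0"
    moreover have "0 \<le> rpow (u x) p * rpow (norm g) q" by (simp add: rpow_nonneg)
    ultimately show ?thesis using subsol[OF x(1)] that by simp
  next
    assume *: "w x > 0 \<and> L < rpow (w x) p * rpow (norm g) q"
    then have "rpow (w x) p * rpow (norm g) q \<le> rpow (u x) p * rpow (norm g) q"
      by (intro mult_right_mono rpow_mono rpow_nonneg p) (use x in auto)
    with * show ?thesis using subsol[OF x(1)] that by simp
  qed
  with gL(1) show "\<exists>g L. has_grad_lap w g L x \<and> (gradient u x = g \<longrightarrow> laplacian u x > L)" by blast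
qed (use x in auto)

section \<open>A priori bound of order |x|^(1-N)\<close>

lemma Keller_Osserman_away:
  obtains A where "A > 0"
    "\<And>x \<epsilon>. x \<in> \<Omega> \<Longrightarrow> 0 < \<epsilon> \<Longrightarrow> \<epsilon> < norm x \<Longrightarrow> u x \<le> A * (norm x - \<epsilon>) powr (1 - N)"
proof -
  \<comment> \<open>The surplus in the exponent condition. With d = |x| - \<epsilon>, the barrier
    has Laplacian of order d^(-N-1), while the nonlinearity is of order d^(-N-1-\<theta>).\<close>
  define \<theta> where "\<theta> = N * (p + q - 1) - p - 1"
  have \<theta>: "\<theta> \<ge> 0" using crit by (simp add: \<theta>_def)
  \<comment> \<open>Chosen so that A N^2 = A^(p+q) R^(-\<theta>); as d \<le> R, the last factor is
    at most d^(-\<theta>).\<close>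
  define A where "A = (N\<^sup>2 * R powr \<theta>) powr (1 / (p + q - 1))"
  have A: "A > 0" "A powr (p + q - 1) = N\<^sup>2 * R powr \<theta>"
    using pq N2 R by (auto simp: A_def powr_powr)
  have "u x \<le> A * (norm x - \<epsilon>) powr (1 - N)" if x: "x \<in> \<Omega>" "0 < \<epsilon>" "\<epsilon> < norm x" for x \<epsilon>
  proof -
    let ?w = "\<lambda>x::'a. A * (norm x - \<epsilon>) powr (1 - N)"
    let ?K = "closure \<Omega> \<inter> {x. norm x \<ge> \<epsilon>}"
    have "compact ?K"
      using bounded by (intro compact_Int_closed)
        (auto simp: compact_closure closed_Collect_le continuous_on_norm_id)
    then have "compact (u ` ?K)"
      using x(2) by (intro compact_continuous_image continuous_on_subset[OF cont]) auto
    then have "bounded (u ` ?K)" by (rule compact_imp_bounded)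
    then obtain M where M: "M > 0" "\<And>y. y \<in> ?K \<Longrightarrow> \<bar>u y\<bar> \<le> M"
      unfolding bounded_pos by auto
    \<comment> \<open>Comparison starts on a slightly larger sphere: close enough to |x| =
      \<epsilon> that the barrier exceeds the bound \<open>M\<close> of \<open>u\<close>, and small
      enough that \<open>x\<close> stays in the region.\<close>
    define \<epsilon>' where "\<epsilon>' = \<epsilon> + min (norm x - \<epsilon>) ((M / A) powr (1 / (1 - N)))"
    have \<epsilon>': "\<epsilon> < \<epsilon>'" "\<epsilon>' \<le> norm x" using x M A by (auto simp: \<epsilon>'_def)
    have hl: "has_grad_lap ?w ((A * (1 - N) * (norm y - \<epsilon>) powr (- N)) *\<^sub>R (y /\<^sub>R norm y))
        (A * (1 - N) * (- N) * (norm y - \<epsilon>) powr (- N - 1) * ((y /\<^sub>R norm y) \<bullet> (y /\<^sub>R norm y))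
          + A * (1 - N) * (norm y - \<epsilon>) powr (- N) * ((N - 1) / norm y)) y"
      if y: "norm y > \<epsilon>" for y
    proof -
      have y0: "y \<noteq> 0" using y x by auto
      have "\<forall>\<^sub>F t in nhds (norm y). t \<in> {\<epsilon><..}"
        by (rule eventually_nhds_in_open) (use y in auto)
      then have "\<forall>\<^sub>F t in nhds (norm y). ((\<lambda>t. A * (t - \<epsilon>) powr (1 - N)) has_real_derivative
          A * (1 - N) * (t - \<epsilon>) powr (- N)) (at t)"
        by eventually_elim (auto intro!: derivative_eq_intros)
      moreover have "((\<lambda>t. A * (1 - N) * (t - \<epsilon>) powr (- N)) has_real_derivative
          A * (1 - N) * (- N) * (norm y - \<epsilon>) powr (- N - 1)) (at (norm y))"
        using y by (auto intro!: derivative_eq_intros)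
      ultimately show ?thesis
        unfolding N_def by (rule has_grad_lap_compose[OF has_grad_lap_norm[OF y0]])
    qed
    show ?thesis
    proof (rule supersolution_bound[of \<epsilon>' ?w])
      show "isCont ?w y \<and> ?w y \<ge> 0" if "norm y \<ge> \<epsilon>'" for y
        using has_grad_lap_continuous[OF hl, of y] that \<epsilon>' A(1) by simp
    next
      fix y assume y: "y \<in> \<Omega>" "norm y = \<epsilon>'"
      have "M / A = ((M / A) powr (1 / (1 - N))) powr (1 - N)"
        using M A N2 by (simp add: powr_powr)
      also have "\<dots> \<le> (\<epsilon>' - \<epsilon>) powr (1 - N)"
        using N2 \<epsilon>'(1) by (intro powr_mono2') (auto simp: \<epsilon>'_def)
      finally have "M \<le> ?w y" using A(1) y by (simp add: field_simps)
      moreover have "y \<in> ?K" using y closure_subset[of \<Omega>] \<epsilon>' by auto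
      then have "\<bar>u y\<bar> \<le> M" by (rule M)
      ultimately show "u y \<le> ?w y" by linarith
    next
      fix y assume y: "y \<in> \<Omega>" "norm y > \<epsilon>'"
      let ?g = "(A * (1 - N) * (norm y - \<epsilon>) powr (- N)) *\<^sub>R (y /\<^sub>R norm y)"
      let ?L = "A * (1 - N) * (- N) * (norm y - \<epsilon>) powr (- N - 1) * ((y /\<^sub>R norm y) \<bullet> (y /\<^sub>R norm y))
          + A * (1 - N) * (norm y - \<epsilon>) powr (- N) * ((N - 1) / norm y)"
      define d where "d = norm y - \<epsilon>"
      have y0: "norm y > 0" using y x \<epsilon>' by linarith
      have "norm y < R" using y sub_ball by auto
      then have d: "d > 0" "d \<le> R" using y \<epsilon>' x by (auto simp: d_def)
      have w0: "?w y > 0" using A d by (simp add: d_def)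
      have one: "(y /\<^sub>R norm y) \<bullet> (y /\<^sub>R norm y) = 1"
        using y0 by (simp add: dot_square_norm power2_eq_square)
      have ng: "norm ?g = A * (N - 1) * d powr (- N)"
        using y0 A N2 by (simp add: abs_mult d_def)
      \<comment> \<open>The first-order part of the radial Laplacian is nonpositive, the barrier
        being decreasing in |y|; only the second derivative remains.\<close>
      have "A * (1 - N) * d powr (- N) * ((N - 1) / norm y) \<le> 0"
        using A N2 y0 by (intro mult_nonpos_nonneg[OF mult_nonpos_nonneg[OF mult_nonneg_nonpos]]) auto
      then have "?L \<le> A * (N - 1) * N * d powr (- N - 1)"
        unfolding one d_def[symmetric] by (simp add: algebra_simps)
      also have "\<dots> < A * N\<^sup>2 * d powr (- N - 1)"
        using A N2 d by (simp add: power2_eq_square)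
      also have "\<dots> = A * (A powr (p + q - 1)) * R powr (- \<theta>) * d powr (- N - 1)"
        unfolding A(2) using R by (simp add: powr_minus field_simps)
      also have "\<dots> \<le> A * (A powr (p + q - 1)) * d powr (- \<theta>) * d powr (- N - 1)"
        using A d \<theta> by (intro mult_right_mono mult_left_mono powr_mono2') auto
      also have "\<dots> = A powr (p + q) * d powr ((1 - N) * p + (- N) * q)"
      proof -
        have "A * A powr (p + q - 1) = A powr (p + q)" using A(1) by (simp add: powr_mult_base)
        moreover have "d powr (- \<theta>) * d powr (- N - 1) = d powr ((1 - N) * p + (- N) * q)"
          unfolding powr_add[symmetric] by (rule arg_cong[of _ _ "(powr) d"]) (simp add: \<theta>_def algebra_simps)
        ultimately show ?thesis by (metis mult.assoc)
      qed
      \<comment> \<open>The factor \<open>N - 1\<close> of the gradient is at least 1, so inserting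
        it only helps.\<close>
      also have "\<dots> \<le> A powr (p + q) * d powr ((1 - N) * p + (- N) * q) * (N - 1) powr q"
        using N2 q A d by (simp add: ge_one_powr_ge_zero)
      also have "\<dots> = (A * d powr (1 - N)) powr p * (A * (N - 1) * d powr (- N)) powr q"
      proof -
        have "d powr ((1 - N) * p + (- N) * q) = (d powr (1 - N)) powr p * (d powr (- N)) powr q"
          by (simp only: powr_add powr_powr)
        then show ?thesis using A N2 d by (simp add: powr_mult powr_add mult_ac)
      qed
      also have "\<dots> = rpow (?w y) p * rpow (norm ?g) q"
        unfolding ng using A N2 d by (simp add: rpow_pos d_def)
      finally show "\<exists>g L. has_grad_lap ?w g L y \<and> (L < 0 \<or> ?w y > 0 \<and> L < rpow (?w y) p * rpow (norm g) q)"
        using hl[of y] y \<epsilon>' w0 by (intro exI[of _ ?g] exI[of _ ?L]) auto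
    qed (use x \<epsilon>' in auto)
  qed
  with A(1) show ?thesis using that by blast
qed

lemma Keller_Osserman:
  obtains A where "A > 0" "\<And>x. x \<in> \<Omega> \<Longrightarrow> u x \<le> A * norm x powr (1 - N)"
proof -
  obtain A where A: "A > 0"
    "\<And>x \<epsilon>. x \<in> \<Omega> \<Longrightarrow> 0 < \<epsilon> \<Longrightarrow> \<epsilon> < norm x \<Longrightarrow> u x \<le> A * (norm x - \<epsilon>) powr (1 - N)"
    using Keller_Osserman_away by blast
  have "u x \<le> A * norm x powr (1 - N)" if x: "x \<in> \<Omega>" for x
  proof (rule tendsto_lowerbound)
    have "((\<lambda>\<epsilon>. A * (norm x - \<epsilon>) powr (1 - N)) \<longlongrightarrow> A * (norm x - 0) powr (1 - N)) (at_right 0)"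
      using nonzero[OF x] by (intro tendsto_intros) auto
    then show "((\<lambda>\<epsilon>. A * (norm x - \<epsilon>) powr (1 - N)) \<longlongrightarrow> A * norm x powr (1 - N)) (at_right 0)" by simp
    have "\<forall>\<^sub>F \<epsilon> in at_right 0. \<epsilon> \<in> {0<..<norm x}"
      using nonzero[OF x] by (intro eventually_at_right_real) auto
    then show "\<forall>\<^sub>F \<epsilon> in at_right 0. u x \<le> A * (norm x - \<epsilon>) powr (1 - N)"
      by eventually_elim (use A(2)[OF x] in auto)
  qed simp
  with A(1) show ?thesis using that by blast
qed

section \<open>Comparison with multiples of the Poisson kernel\<close>

abbreviation P :: "'a \<Rightarrow> real" where "P x \<equiv> ext_fun c x * norm x powr (- N)"

text \<open>A strictly superharmonic corrector, nonnegative on the closure of \<Omega>. Gradient and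
  Laplacian are left unsimplified, as the rules produce them.\<close>

lemma has_grad_lap_cap:
  "has_grad_lap (\<lambda>x::'a. \<kappa> * (R\<^sup>2 + (-1) * (x \<bullet> x))) (\<kappa> *\<^sub>R (0 + (-1) *\<^sub>R 2 *\<^sub>R x)) (\<kappa> * (0 + (-1) * (2 * N))) x"
  unfolding N_def
  by (intro has_grad_lap_cmult has_grad_lap_add has_grad_lap_const has_grad_lap_inner_self)

text \<open>
  The pole of this kernel is \<open>-h c\<close>, and its ball, with antipodal points \<open>-h c\<close> and \<open>-(1 - h) c\<close>, is
  shrunk inside the original one, so it stays positive on \<open>closure \<Omega>\<close> and is of order \<open>\<epsilon>\<^sup>1\<^sup>-\<^sup>N\<close> on
  \<open>|x| = \<epsilon> = h |c|\<close>.
\<close>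

lemma shifted_poisson_bound:
  assumes A: "A > 0" "\<And>x. x \<in> \<Omega> \<Longrightarrow> u x \<le> A * norm x powr (1 - N)"
    and h: "0 < h" "h < 1 / 2" and x: "x \<in> \<Omega>" "norm x \<ge> h * norm c"
  shows "u x \<le> 2 * 2 powr N * A / norm c * ((ext_fun c x + (h - h\<^sup>2) * (c \<bullet> c)) * norm (x + h *\<^sub>R c) powr (- N))
           + h * (R\<^sup>2 + (-1) * (x \<bullet> x))"
proof -
  \<comment> \<open>On |x| = \<epsilon> the shifted \<open>ext_fun\<close> is at least
    \<epsilon>|c|/2 and the pole is at distance at most 2\<epsilon>; this factor turns the resulting
    lower bound into exactly A \<epsilon>^(1-N).\<close>
  let ?k = "2 * 2 powr N * A / norm c"
  define \<epsilon> where "\<epsilon> = h * norm c"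
  have \<epsilon>: "\<epsilon> > 0" using h c by (simp add: \<epsilon>_def)
  have "h * h \<le> h * (1 / 2)" using h by (intro mult_left_mono) auto
  then have h2: "h - h\<^sup>2 \<ge> h / 2" by (simp add: power2_eq_square)
  let ?Q = "\<lambda>x. ext_fun ((1 - 2 * h) *\<^sub>R c) (x + h *\<^sub>R c) * norm (x + h *\<^sub>R c) powr (- N)"
  let ?w = "\<lambda>x. ?k * ?Q x + h * (R\<^sup>2 + (-1) * (x \<bullet> x))"
  \<comment> \<open>The two balls are concentric, so their functions differ by a constant, which is
    positive for 0 < h < 1.\<close>
  have eq: "ext_fun ((1 - 2 * h) *\<^sub>R c) (x + h *\<^sub>R c) = ext_fun c x + (h - h\<^sup>2) * (c \<bullet> c)" for x
    by (simp add: ext_fun_def inner_add_left inner_add_right inner_commute[of c x] power2_eq_square algebra_simps)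
  have cc: "c \<bullet> c > 0" using c by simp
  have k: "?k > 0" using A c by simp
  have hl: "\<exists>g. has_grad_lap ?w g (?k * 0 + h * (0 + (-1) * (2 * N))) x" if x: "x \<in> closure \<Omega>" for x
  proof -
    have "(h - h\<^sup>2) * (c \<bullet> c) > 0" using h2 h cc by (intro mult_pos_pos) auto
    then have "ext_fun ((1 - 2 * h) *\<^sub>R c) (x + h *\<^sub>R c) > 0"
      unfolding eq using closure_ext[OF x] by linarith
    then have "x + h *\<^sub>R c \<noteq> 0" by (metis add_cancel_left_left ext_fun_def inner_zero_left less_irrefl)
    note shift = has_grad_lap_shift[OF has_grad_lap_poisson[OF this, of "(1 - 2 * h) *\<^sub>R c", folded N_def]]
    show ?thesis
      by (intro exI) (rule has_grad_lap_add[OF has_grad_lap_cmult[OF shift] has_grad_lap_cap])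
  qed
  have w0: "?w x \<ge> 0" if "x \<in> closure \<Omega>" for x
  proof -
    have "?Q x \<ge> 0"
      unfolding eq using closure_ext[OF that] h h2 by (intro mult_nonneg_nonneg add_nonneg_nonneg) auto
    then have "?k * ?Q x \<ge> 0" by (rule mult_nonneg_nonneg[OF less_imp_le[OF k]])
    moreover have "h * (R\<^sup>2 + (-1) * (x \<bullet> x)) \<ge> 0" using h closure_inner[OF that] by simp
    ultimately show ?thesis by (rule add_nonneg_nonneg)
  qed
  have "u x \<le> ?w x"
  proof (rule supersolution_bound[OF \<epsilon>])
    show "isCont ?w x \<and> ?w x \<ge> 0" if "x \<in> closure \<Omega>" for x
      using hl[OF that] w0[OF that] has_grad_lap_continuous by blast
    show "\<exists>g L. has_grad_lap ?w g L x \<and> (L < 0 \<or> ?w x > 0 \<and> L < rpow (?w x) p * rpow (norm g) q)"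
      if x: "x \<in> \<Omega>" for x
    proof -
      \<comment> \<open>The shifted kernel is harmonic, so the corrector alone makes the Laplacian
        negative.\<close>
      have "?k * 0 + h * (0 + (-1) * (2 * N)) < 0" using h N2 by simp
      then show ?thesis using hl x closure_subset[of \<Omega>] by blast
    qed
  next
    fix x assume x: "x \<in> \<Omega>" "norm x = \<epsilon>"
    have cl: "x \<in> closure \<Omega>" using x closure_subset by auto
    have "norm (x + h *\<^sub>R c) \<le> 2 * \<epsilon>"
      using norm_triangle_ineq[of x "h *\<^sub>R c"] x h by (simp add: \<epsilon>_def)
    moreover have "x + h *\<^sub>R c \<noteq> 0"
    proof
      assume "x + h *\<^sub>R c = 0"
      then have "x = - h *\<^sub>R c" by (simp add: add_eq_0_iff)
      then have "ext_fun c x = (h\<^sup>2 - h) * (c \<bullet> c)"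
        by (simp add: ext_fun_def power2_eq_square algebra_simps)
      also have "\<dots> \<le> 0" using h2 h cc by (intro mult_nonpos_nonneg) auto
      finally show False using ext[OF x(1)] by simp
    qed
    ultimately have "(2 * \<epsilon>) powr (- N) \<le> norm (x + h *\<^sub>R c) powr (- N)"
      using N2 by (intro powr_mono2') auto
    moreover have "\<epsilon> * norm c / 2 \<le> ext_fun ((1 - 2 * h) *\<^sub>R c) (x + h *\<^sub>R c)"
    proof -
      have "\<epsilon> * norm c / 2 = (h / 2) * (c \<bullet> c)" by (simp add: \<epsilon>_def dot_square_norm power2_eq_square)
      also have "\<dots> \<le> (h - h\<^sup>2) * (c \<bullet> c)" by (intro mult_right_mono h2) auto
      finally show ?thesis unfolding eq using closure_ext[OF cl] by linarith
    qed
    moreover have "0 \<le> \<epsilon> * norm c / 2" using \<epsilon> by simp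
    ultimately have "(\<epsilon> * norm c / 2) * (2 * \<epsilon>) powr (- N) \<le> ?Q x"
      by (intro mult_mono) (linarith | simp)+
    then have "?k * ((\<epsilon> * norm c / 2) * (2 * \<epsilon>) powr (- N)) \<le> ?k * ?Q x"
      using k by (intro mult_left_mono) auto
    moreover have "?k * ((\<epsilon> * norm c / 2) * (2 * \<epsilon>) powr (- N)) = A * \<epsilon> powr (1 - N)"
    proof -
      have "\<epsilon> powr (1 - N) = \<epsilon> * \<epsilon> powr (- N)" using \<epsilon> by (simp add: powr_mult_base)
      moreover have "2 powr N * 2 powr (- N) = (1::real)" by (simp add: powr_minus)
      ultimately show ?thesis using \<epsilon> c by (simp add: powr_mult field_simps)
    qed
    moreover have "0 \<le> h * (R\<^sup>2 + (-1) * (x \<bullet> x))" using h closure_inner[OF cl] by simp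
    ultimately show "u x \<le> ?w x" using A(2)[OF x(1)] x(2) by simp
  qed (use x \<epsilon>_def in auto)
  then show ?thesis unfolding eq .
qed

text \<open>The constant in \<open>shifted_poisson_bound\<close> does not depend on
  \<open>h\<close>, so the pole may be moved back to 0.\<close>

lemma poisson_bound:
  obtains k where "k > 0" "\<And>x. x \<in> \<Omega> \<Longrightarrow> u x \<le> k * P x"
proof -
  obtain A where A: "A > 0" "\<And>x. x \<in> \<Omega> \<Longrightarrow> u x \<le> A * norm x powr (1 - N)"
    using Keller_Osserman by blast
  let ?k = "2 * 2 powr N * A / norm c"
  have "u x \<le> ?k * P x" if x: "x \<in> \<Omega>" for x
  proof (rule tendsto_lowerbound)
    let ?f = "\<lambda>h. ?k * ((ext_fun c x + (h - h\<^sup>2) * (c \<bullet> c)) * norm (x + h *\<^sub>R c) powr (- N))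
           + h * (R\<^sup>2 + (-1) * (x \<bullet> x))"
    have "(?f \<longlongrightarrow> ?k * ((ext_fun c x + (0 - 0\<^sup>2) * (c \<bullet> c)) * norm (x + 0 *\<^sub>R c) powr (- N))
           + 0 * (R\<^sup>2 + (-1) * (x \<bullet> x))) (at_right 0)"
      using nonzero[OF x] by (intro tendsto_intros) auto
    then show "(?f \<longlongrightarrow> ?k * P x) (at_right 0)" by simp
    have "\<forall>\<^sub>F h in at_right 0. h \<in> {0<..<min (1 / 2) (norm x / norm c)}"
      using nonzero[OF x] c by (intro eventually_at_right_real) auto
    then show "\<forall>\<^sub>F h in at_right 0. u x \<le> ?f h"
      by eventually_elim (rule shifted_poisson_bound[OF A _ _ x], use c in \<open>auto simp: field_simps\<close>)
  qed simp
  moreover have "?k > 0" using A c by simp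
  ultimately show ?thesis using that by blast
qed

text \<open>Compare \<open>u\<close> with (k - \<delta>) P + \<delta> \<epsilon> layer + C
  \<epsilon> (R^2 - |x|^2): on |x| = \<epsilon> the layer restores the missing \<delta> P, and both
  corrections vanish as \<epsilon> \<rightarrow> 0. The nonlinearity is used only near 0 and away
  from the sphere, where P and its gradient have full size |x|^(1-N) and |x|^(-N). With \<delta>
  \<le> k/2 those lower bounds do not depend on \<delta>.\<close>

lemma poisson_bound_improve:
  assumes k: "k > 0" and uk: "\<And>x. x \<in> \<Omega> \<Longrightarrow> u x \<le> k * P x"
  obtains \<delta> where "\<delta> > 0" "\<delta> \<le> k / 2" "\<And>x. x \<in> \<Omega> \<Longrightarrow> u x \<le> (k - \<delta>) * P x"
proof -
  define \<Lambda> where "\<Lambda> = 2 * R + norm c"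
  have nc: "norm c > 0" using c by simp
  have \<Lambda>: "\<Lambda> > 0" unfolding \<Lambda>_def using R nc by linarith
  \<comment> \<open>The value of ext_fun / |x| at which the upper bound for the Laplacian of the
    layer changes sign.\<close>
  define \<tau> where "\<tau> = (c \<bullet> c) / (\<Lambda> * (N + 1))"
  have \<tau>: "\<tau> > 0" using \<Lambda> c N2 by (simp add: \<tau>_def)
  \<comment> \<open>Below this radius \<open>poisson_grad_lower\<close> applies; the cutoff at 1
    allows powers of |x| to be compared by exponents.\<close>
  define R0 where "R0 = min 1 (3 * (c \<bullet> c) / (8 * N * \<Lambda>))"
  have R0: "R0 > 0" "R0 \<le> 1" "8 * N * \<Lambda> * R0 \<le> 3 * (c \<bullet> c)"
    using \<Lambda> c N2 by (auto simp: R0_def field_simps min_def)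
  \<comment> \<open>Targets w \<ge> c1 |x|^(1-N) and |\<nabla>w| \<ge> c2 |x|^(-N) in the critical
    region. The kernel supplies gradient at least 4 c2 |x|^(-N), of which layer and cap may each
    cancel c2 |x|^(-N).\<close>
  define c1 where "c1 = k * \<tau> / 2"
  define c2 where "c2 = k * norm c / 16"
  have c12: "c1 > 0" "c2 > 0" using k \<tau> nc by (auto simp: c1_def c2_def)
  define D where "D = 2 * (N + 1) * \<Lambda>"
  have D: "D > 0" using \<Lambda> N2 by (simp add: D_def)
  \<comment> \<open>The three bounds keep k - \<delta> \<ge> k/2, limit the gradient of the layer,
    and let the nonlinearity absorb its Laplacian, at most D |x|^(-N-2).\<close>
  define \<delta> where "\<delta> = min (k / 2) (min (c2 / ((3 * N + 8) * \<Lambda>)) (c1 powr p * c2 powr q / D))"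
  have \<delta>: "\<delta> > 0" "\<delta> \<le> k / 2" "\<delta> * ((3 * N + 8) * \<Lambda>) \<le> c2" "\<delta> * D \<le> c1 powr p * c2 powr q"
  proof -
    show "\<delta> \<le> k / 2" unfolding \<delta>_def by (rule min.cobounded1)
    have "\<delta> \<le> c2 / ((3 * N + 8) * \<Lambda>)" "\<delta> \<le> c1 powr p * c2 powr q / D"
      by (auto simp: \<delta>_def)
    then show "\<delta> * ((3 * N + 8) * \<Lambda>) \<le> c2" "\<delta> * D \<le> c1 powr p * c2 powr q"
      using \<Lambda> N2 D by (simp_all add: pos_le_divide_eq)
  qed (use k c12 \<Lambda> N2 D in \<open>auto simp: \<delta>_def\<close>)
  \<comment> \<open>For |x| \<ge> R0 the layer term has Laplacian at most C \<epsilon>, less than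
    the cap takes away. The choice of \<open>\<epsilon>0\<close> below keeps the gradient of the cap
    small.\<close>
  define C where "C = \<delta> * D * R0 powr (- N - 2)"
  have C: "C > 0" using \<delta> D R0 by (simp add: C_def)
  define \<epsilon>0 where "\<epsilon>0 = c2 / (2 * C)"
  have \<epsilon>0: "\<epsilon>0 > 0" using c12 C by (simp add: \<epsilon>0_def)
  have sL: "ext_fun c x \<le> \<Lambda> * norm x" "norm (2 *\<^sub>R x + c) \<le> \<Lambda>" if x: "x \<in> closure \<Omega>" for x
  proof -
    have "ext_fun c x \<le> norm x * norm x + norm x * norm c"
      using norm_cauchy_schwarz[of x c] by (simp add: ext_fun_def dot_square_norm power2_eq_square)
    also have "\<dots> = (norm x + norm c) * norm x" by (simp add: algebra_simps)
    also have "\<dots> \<le> \<Lambda> * norm x"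
      using closure_norm[OF x] R by (intro mult_right_mono) (auto simp: \<Lambda>_def)
    finally show "ext_fun c x \<le> \<Lambda> * norm x" .
    show "norm (2 *\<^sub>R x + c) \<le> \<Lambda>"
      using norm_triangle_ineq[of "2 *\<^sub>R x" c] closure_norm[OF x] by (simp add: \<Lambda>_def)
  qed
  \<comment> \<open>The cap \<open>C \<epsilon> (R\<^sup>2 - |x|\<^sup>2)\<close> makes the barrier superharmonic for \<open>|x| \<ge> R0\<close>, where \<open>\<nabla>P\<close> may vanish.\<close>
  have main: "u x \<le> (k - \<delta>) * P x + (\<delta> * \<epsilon>) * layer c \<Lambda> x + (C * \<epsilon>) * (R\<^sup>2 + (-1) * (x \<bullet> x))"
    if \<epsilon>: "0 < \<epsilon>" "\<epsilon> < \<epsilon>0" and x: "x \<in> \<Omega>" "norm x \<ge> \<epsilon>" for x \<epsilon>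
  proof -
    let ?w = "\<lambda>x. (k - \<delta>) * P x + (\<delta> * \<epsilon>) * layer c \<Lambda> x + (C * \<epsilon>) * (R\<^sup>2 + (-1) * (x \<bullet> x))"
    let ?gP = "\<lambda>x. norm x powr (- N) *\<^sub>R (2 *\<^sub>R x + c) - (N * ext_fun c x * norm x powr (- N - 2)) *\<^sub>R x"
    have kd: "k - \<delta> \<ge> k / 2" "k - \<delta> > 0" using \<delta> k by auto
    have hl: "\<exists>g L. has_grad_lap ?w ((k - \<delta>) *\<^sub>R ?gP x + (\<delta> * \<epsilon>) *\<^sub>R g + (- (2 * C * \<epsilon>)) *\<^sub>R x)
        (\<delta> * \<epsilon> * L - 2 * C * \<epsilon> * N) x \<and>
        norm g \<le> (3 * N + 8) * \<Lambda> * norm x powr (- N - 1) \<and>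
        L \<le> norm x powr (- N - 2) * (2 * (N + 1) * (ext_fun c x / norm x) - 2 * (c \<bullet> c) / \<Lambda>)"
      if x: "x \<in> closure \<Omega>" "norm x \<ge> \<epsilon>" for x
    proof -
      have x0: "x \<noteq> 0" using x \<epsilon> by auto
      obtain g L where gL: "has_grad_lap (layer c \<Lambda>) g L x" "norm g \<le> (3 * N + 8) * \<Lambda> * norm x powr (- N - 1)"
        "L \<le> norm x powr (- N - 2) * (2 * (N + 1) * (ext_fun c x / norm x) - 2 * (c \<bullet> c) / \<Lambda>)"
        using has_grad_lap_layer[OF x0 \<Lambda> closure_ext[OF x(1)] sL[OF x(1)], folded N_def] by blast
      have "has_grad_lap ?w ((k - \<delta>) *\<^sub>R ?gP x + (\<delta> * \<epsilon>) *\<^sub>R g + (C * \<epsilon>) *\<^sub>R (0 + (-1) *\<^sub>R 2 *\<^sub>R x))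
        ((k - \<delta>) * 0 + \<delta> * \<epsilon> * L + C * \<epsilon> * (0 + (-1) * (2 * N))) x"
        by (intro has_grad_lap_add has_grad_lap_cap has_grad_lap_cmult[OF gL(1)]
            has_grad_lap_cmult[OF has_grad_lap_poisson[OF x0, of c, folded N_def]])
      with gL(2,3) show ?thesis by (intro exI[of _ g] exI[of _ L]) (simp add: mult_ac)
    qed
    have Fge: "layer c \<Lambda> x \<ge> ext_fun c x * norm x powr (- N - 1)"
      if x: "x \<in> closure \<Omega>" "norm x \<ge> \<epsilon>" for x
      unfolding N_def by (rule layer_ge) (use x \<epsilon> \<Lambda> closure_ext sL in auto)
    have cap: "(C * \<epsilon>) * (R\<^sup>2 + (-1) * (x \<bullet> x)) \<ge> 0" if "x \<in> closure \<Omega>" for x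
      using C \<epsilon> closure_inner[OF that] by simp
    have wge: "?w x \<ge> (k / 2) * P x" if x: "x \<in> closure \<Omega>" "norm x \<ge> \<epsilon>" for x
    proof -
      have "(k - \<delta>) * P x \<ge> (k / 2) * P x"
        using kd closure_ext[OF x(1)] by (intro mult_right_mono) auto
      moreover have "ext_fun c x * norm x powr (- N - 1) \<ge> 0" using closure_ext[OF x(1)] by simp
      then have "(\<delta> * \<epsilon>) * layer c \<Lambda> x \<ge> 0"
        using \<delta> \<epsilon> Fge[OF x] by (intro mult_nonneg_nonneg) auto
      ultimately show ?thesis using cap[OF x(1)] by linarith
    qed
    show ?thesis
    proof (rule supersolution_bound[OF \<epsilon>(1), of ?w])
      fix x assume x: "x \<in> closure \<Omega>" "norm x \<ge> \<epsilon>"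
      have "0 \<le> (k / 2) * P x" using k closure_ext[OF x(1)] by simp
      then show "isCont ?w x \<and> ?w x \<ge> 0"
        using wge[OF x] hl[OF x] has_grad_lap_continuous by fastforce
    next
      fix x assume x: "x \<in> \<Omega>" "norm x = \<epsilon>"
      then have cl: "x \<in> closure \<Omega>" using closure_subset by auto
      \<comment> \<open>On the inner sphere \<epsilon> times the layer is at least \<open>P\<close>,
        so \<open>w \<ge> k P \<ge> u\<close> there.\<close>
      have "\<epsilon> * (ext_fun c x * \<epsilon> powr (- N - 1)) = P x"
        using x \<epsilon> by (simp add: powr_mult_base mult.left_commute)
      moreover have "\<epsilon> * (ext_fun c x * \<epsilon> powr (- N - 1)) \<le> \<epsilon> * layer c \<Lambda> x"
        using Fge[OF cl] x \<epsilon> by (intro mult_left_mono) auto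
      ultimately have "P x \<le> \<epsilon> * layer c \<Lambda> x" by linarith
      then have "\<delta> * P x \<le> \<delta> * (\<epsilon> * layer c \<Lambda> x)"
        using \<delta>(1) by (intro mult_left_mono) auto
      then show "u x \<le> ?w x" using uk[OF x(1)] cap[OF cl] by (simp add: algebra_simps)
    next
      fix x assume x: "x \<in> \<Omega>" "norm x > \<epsilon>"
      then have cl: "x \<in> closure \<Omega>" "norm x \<ge> \<epsilon>" using closure_subset by auto
      define r where "r = norm x"
      define \<sigma> where "\<sigma> = ext_fun c x / r"
      have r: "r > 0" "r \<ge> \<epsilon>" using x \<epsilon> by (auto simp: r_def)
      have \<sigma>: "\<sigma> \<ge> 0" "\<sigma> \<le> \<Lambda>" "ext_fun c x = \<sigma> * r"
        using r sL(1)[OF cl(1)] closure_ext[OF cl(1)] by (auto simp: \<sigma>_def field_simps r_def)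
      obtain g L where gL:
        "has_grad_lap ?w ((k - \<delta>) *\<^sub>R ?gP x + (\<delta> * \<epsilon>) *\<^sub>R g + (- (2 * C * \<epsilon>)) *\<^sub>R x)
          (\<delta> * \<epsilon> * L - 2 * C * \<epsilon> * N) x"
        "norm g \<le> (3 * N + 8) * \<Lambda> * r powr (- N - 1)"
        "L \<le> r powr (- N - 2) * (2 * (N + 1) * \<sigma> - 2 * (c \<bullet> c) / \<Lambda>)"
        using hl[OF cl] unfolding r_def[symmetric] \<sigma>_def[symmetric] by blast
      let ?g = "(k - \<delta>) *\<^sub>R ?gP x + (\<delta> * \<epsilon>) *\<^sub>R g + (- (2 * C * \<epsilon>)) *\<^sub>R x"
      let ?L = "\<delta> * \<epsilon> * L - 2 * C * \<epsilon> * N"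
      have pos: "2 * C * \<epsilon> * N > C * \<epsilon>" using C \<epsilon> N2 by (simp add: mult.commute)
      have LD: "L \<le> r powr (- N - 2) * D"
      proof -
        have "2 * (N + 1) * \<sigma> \<le> D" unfolding D_def using \<sigma> N2 by (intro mult_left_mono) auto
        moreover have "2 * (c \<bullet> c) / \<Lambda> \<ge> 0" using \<Lambda> by simp
        ultimately have "r powr (- N - 2) * (2 * (N + 1) * \<sigma> - 2 * (c \<bullet> c) / \<Lambda>) \<le> r powr (- N - 2) * D"
          by (intro mult_left_mono) auto
        with gL(3) show ?thesis by linarith
      qed
      \<comment> \<open>Near the sphere the layer is superharmonic; away from 0 the cap wins; in the
        remaining region the nonlinearity does.\<close>
      consider "\<sigma> < \<tau>" | "r \<ge> R0" | "\<sigma> \<ge> \<tau>" "r < R0" by linarith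
      then have "?L < 0 \<or> ?w x > 0 \<and> ?L < rpow (?w x) p * rpow (norm ?g) q"
      proof cases
        case 1
        have "2 * (N + 1) * \<sigma> \<le> 2 * (N + 1) * \<tau>" using 1 N2 by (intro mult_left_mono) auto
        also have "\<dots> = 2 * (c \<bullet> c) / \<Lambda>"
        proof -
          have "M * (b / (\<Lambda> * M)) = b / \<Lambda>" if "M > 0" for M b :: real
            using that by simp
          from this[of "N + 1" "c \<bullet> c"] have "(N + 1) * \<tau> = (c \<bullet> c) / \<Lambda>"
            unfolding \<tau>_def using N2 by linarith
          then show ?thesis by (simp only: mult.assoc times_divide_eq_right)
        qed
        finally have "r powr (- N - 2) * (2 * (N + 1) * \<sigma> - 2 * (c \<bullet> c) / \<Lambda>) \<le> 0"
          by (intro mult_nonneg_nonpos) auto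
        then have "\<delta> * \<epsilon> * L \<le> 0" using gL(3) \<delta> \<epsilon> by (intro mult_nonneg_nonpos) auto
        moreover have "C * \<epsilon> > 0" using C \<epsilon> by simp
        ultimately show ?thesis using pos by linarith
      next
        case 2
        have "r powr (- N - 2) \<le> R0 powr (- N - 2)" using 2 R0 N2 by (intro powr_mono2') auto
        then have "r powr (- N - 2) * D \<le> R0 powr (- N - 2) * D" using D by (intro mult_right_mono) auto
        then have "\<delta> * \<epsilon> * L \<le> \<delta> * \<epsilon> * (R0 powr (- N - 2) * D)"
          using LD \<delta> \<epsilon> by (intro mult_left_mono) auto
        also have "\<dots> = C * \<epsilon>" by (simp add: C_def)
        finally show ?thesis using pos by linarith
      next
        case 3
        have r1: "r \<le> 1" using 3 R0 by simp
        define t where "t = r powr (- N)"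
        have t: "t > 0" "r powr (1 - N) = r * t" "t = r * r powr (- N - 1)" "r powr (- N - 1) = r * r powr (- N - 2)"
          using r by (auto simp: t_def powr_mult_base minus_diff_commute)
        have "c1 * r powr (1 - N) = (k / 2) * (\<tau> * r * t)" by (simp add: c1_def t)
        also have "\<dots> \<le> (k / 2) * (\<sigma> * r * t)"
          using k 3 r t by (intro mult_left_mono mult_right_mono) auto
        also have "\<dots> = (k / 2) * P x" unfolding \<sigma>(3) by (simp add: t_def r_def)
        finally have w: "?w x \<ge> c1 * r powr (1 - N)" using wge[OF cl] by linarith
        have wpos: "c1 * r powr (1 - N) > 0" using c12 r by simp
        have "c2 * t \<le> norm ?g"
        proof -
          have "norm (a + b + d) \<ge> norm a - norm b - norm d" for a b d :: 'a
            by norm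
          then have "norm ?g \<ge> norm ((k - \<delta>) *\<^sub>R ?gP x) - norm ((\<delta> * \<epsilon>) *\<^sub>R g) - norm ((- (2 * C * \<epsilon>)) *\<^sub>R x)"
            .
          moreover have "norm ((k - \<delta>) *\<^sub>R ?gP x) \<ge> (k / 2) * (norm c / 2 * t)"
          proof -
            have "8 * N * \<Lambda> * norm x \<le> 8 * N * \<Lambda> * R0"
              using 3 N2 \<Lambda> by (intro mult_left_mono) (auto simp: r_def)
            then have "8 * N * \<Lambda> * norm x \<le> 3 * (c \<bullet> c)" using R0(3) by linarith
            then have "norm c / 2 * t \<le> norm (?gP x)"
              using poisson_grad_lower[OF nonzero[OF x(1)] \<Lambda> closure_ext[OF cl(1)] sL(1)[OF cl(1)]] N2
              unfolding N_def t_def r_def by blast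
            then have "(k / 2) * (norm c / 2 * t) \<le> (k - \<delta>) * norm (?gP x)"
              using kd k t nc by (intro mult_mono) auto
            then show ?thesis using kd by simp
          qed
          moreover have "norm ((\<delta> * \<epsilon>) *\<^sub>R g) \<le> c2 * t"
          proof -
            have "norm ((\<delta> * \<epsilon>) *\<^sub>R g) \<le> \<delta> * \<epsilon> * ((3 * N + 8) * \<Lambda> * r powr (- N - 1))"
              using gL(2) \<delta> \<epsilon> by (simp add: mult_left_mono)
            also have "\<dots> = (\<delta> * ((3 * N + 8) * \<Lambda>)) * (\<epsilon> * r powr (- N - 1))" by simp
            also have "\<dots> \<le> c2 * (r * r powr (- N - 1))"
              using \<delta> r c12 \<epsilon> by (intro mult_mono) auto
            finally show ?thesis using t by simp
          qed
          moreover have "norm ((- (2 * C * \<epsilon>)) *\<^sub>R x) \<le> c2 * t"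
          proof -
            have "2 * C * \<epsilon> \<le> c2" using \<epsilon> C by (simp add: \<epsilon>0_def field_simps)
            moreover have "r \<le> t"
              unfolding t_def using powr_mono'[of "- N" 1 r] r r1 N2 by simp
            ultimately have "2 * C * \<epsilon> * r \<le> c2 * t"
              using C \<epsilon> r c12 by (intro mult_mono) auto
            then show ?thesis using C \<epsilon> by (simp add: r_def)
          qed
          moreover have "(k / 2) * (norm c / 2 * t) = 4 * (c2 * t)" by (simp add: c2_def)
          moreover have "c2 * t > 0" using c12 t by simp
          ultimately show ?thesis by linarith
        qed
        then have g: "c2 * r powr (- N) \<le> norm ?g" by (simp add: t_def)
        have gpos: "c2 * r powr (- N) > 0" using c12 r by simp
        have "\<delta> * \<epsilon> * L \<le> \<delta> * \<epsilon> * (r powr (- N - 2) * D)"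
          using LD \<delta> \<epsilon> by (intro mult_left_mono) auto
        \<comment> \<open>Trading \<epsilon> for the larger r gains one power: -N-2 becomes -N-1,
          the scale of the nonlinearity.\<close>
        also have "\<dots> \<le> \<delta> * r * (r powr (- N - 2) * D)"
          using \<delta> r D by (intro mult_right_mono mult_left_mono) auto
        also have "\<dots> = (\<delta> * D) * r powr (- N - 1)" unfolding t(4) by simp
        also have "\<dots> \<le> (c1 powr p * c2 powr q) * r powr (- N - 1)"
          by (intro mult_right_mono \<delta>) auto
        \<comment> \<open>The exponent condition says (1-N)p - Nq \<le> -N-1, and r \<le> 1.\<close>
        also have "\<dots> \<le> (c1 powr p * c2 powr q) * r powr ((1 - N) * p + (- N) * q)"
          using r r1 crit by (intro mult_left_mono powr_mono') (auto simp: algebra_simps)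
        also have "\<dots> = (c1 * r powr (1 - N)) powr p * (c2 * r powr (- N)) powr q"
        proof -
          have "r powr ((1 - N) * p + (- N) * q) = (r powr (1 - N)) powr p * (r powr (- N)) powr q"
            by (simp only: powr_add powr_powr)
          then show ?thesis using c12 by (simp add: powr_mult)
        qed
        also have "\<dots> = rpow (c1 * r powr (1 - N)) p * rpow (c2 * r powr (- N)) q"
          using wpos gpos by (simp add: rpow_pos)
        also have "\<dots> \<le> rpow (?w x) p * rpow (norm ?g) q"
          by (intro mult_mono rpow_mono w g wpos gpos p q rpow_nonneg)
        finally have "\<delta> * \<epsilon> * L \<le> rpow (?w x) p * rpow (norm ?g) q" .
        moreover have "C * \<epsilon> > 0" using C \<epsilon> by simp
        ultimately have "?L < rpow (?w x) p * rpow (norm ?g) q" using pos by linarith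
        moreover have "?w x > 0" using w wpos by linarith
        ultimately show ?thesis by blast
      qed
      with gL(1) show "\<exists>g L. has_grad_lap ?w g L x \<and> (L < 0 \<or> ?w x > 0 \<and> L < rpow (?w x) p * rpow (norm g) q)"
        by blast
    qed (use x in auto)
  qed
  have "u x \<le> (k - \<delta>) * P x" if x: "x \<in> \<Omega>" for x
  proof (rule tendsto_lowerbound)
    let ?f = "\<lambda>\<epsilon>. (k - \<delta>) * P x + (\<delta> * \<epsilon>) * layer c \<Lambda> x + (C * \<epsilon>) * (R\<^sup>2 + (-1) * (x \<bullet> x))"
    have "(?f \<longlongrightarrow> (k - \<delta>) * P x + (\<delta> * 0) * layer c \<Lambda> x + (C * 0) * (R\<^sup>2 + (-1) * (x \<bullet> x))) (at_right 0)"
      by (intro tendsto_intros)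
    then show "(?f \<longlongrightarrow> (k - \<delta>) * P x) (at_right 0)" by simp
    have "\<forall>\<^sub>F \<epsilon> in at_right 0. \<epsilon> \<in> {0<..<min \<epsilon>0 (norm x)}"
      using nonzero[OF x] \<epsilon>0 by (intro eventually_at_right_real) auto
    then show "\<forall>\<^sub>F \<epsilon> in at_right 0. u x \<le> ?f \<epsilon>"
      by eventually_elim (rule main, use x in auto)
  qed simp
  with \<delta> show ?thesis using that by blast
qed

lemma nonpos:
  assumes x: "x \<in> \<Omega>"
  shows "u x \<le> 0"
proof -
  define S where "S = {k. 0 \<le> k \<and> (\<forall>x\<in>\<Omega>. u x \<le> k * P x)}"
  obtain k0 where "k0 > 0" "\<And>x. x \<in> \<Omega> \<Longrightarrow> u x \<le> k0 * P x" using poisson_bound by blast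
  then have "k0 \<in> S" by (simp add: S_def)
  then have ne: "S \<noteq> {}" by blast
  have below: "bdd_below S" by (rule bdd_belowI[of _ 0]) (auto simp: S_def)
  let ?k = "Inf S"
  have Ppos: "P y > 0" if "y \<in> \<Omega>" for y using ext[OF that] nonzero[OF that] by simp
  have k0: "?k \<ge> 0" using ne by (intro cInf_greatest) (auto simp: S_def)
  \<comment> \<open>The infimum is itself admissible: as P > 0, the constraint at each point is a
    lower bound u/P for \<open>k\<close>.\<close>
  have uk: "u y \<le> ?k * P y" if y: "y \<in> \<Omega>" for y
  proof -
    have "u y / P y \<le> ?k"
      using ne Ppos[OF y] y by (intro cInf_greatest) (auto simp: S_def pos_divide_le_eq)
    then show ?thesis using Ppos[OF y] by (simp add: pos_divide_le_eq)
  qed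
  have "?k = 0"
  proof (rule ccontr)
    assume "?k \<noteq> 0"
    with k0 have "?k > 0" by simp
    then obtain \<delta> where \<delta>: "\<delta> > 0" "\<delta> \<le> ?k / 2" "\<And>x. x \<in> \<Omega> \<Longrightarrow> u x \<le> (?k - \<delta>) * P x"
      using poisson_bound_improve[of ?k] uk by blast
    \<comment> \<open>Membership also requires \<open>?k - \<delta> \<ge> 0\<close>, which follows
      from \<open>\<delta> \<le> ?k / 2\<close>.\<close>
    then have "?k - \<delta> \<in> S" using k0 by (auto simp: S_def)
    then have "?k \<le> ?k - \<delta>" using below by (rule cInf_lower)
    with \<delta>(1) show False by simp
  qed
  with uk[OF x] show ?thesis by simp
qed

end

section \<open>Application to the two nonlinearities\<close>

lemma subsolution_nonpos:
  fixes \<Omega> :: "'a::euclidean_space set"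
  assumes dim: "DIM('a) \<ge> 2" and domain: "bounded_Ck_domain 2 \<Omega>" "0 \<in> frontier \<Omega>"
    and u: "Ck_on 2 u \<Omega>" "continuous_on (closure \<Omega> - {0}) u" "\<forall>x\<in>frontier \<Omega> - {0}. u x = 0"
    and pq: "p \<ge> 0" "q \<ge> 0" "real DIM('a) * (p + q - 1) \<ge> p + 1"
    and sub: "\<And>x. x \<in> \<Omega> \<Longrightarrow> laplacian u x \<ge> rpow (u x) p * rpow (norm (gradient u x)) q"
    and x: "x \<in> \<Omega>"
  shows "u x \<le> 0"
proof -
  obtain c where c: "c \<noteq> 0" "\<And>x. x \<in> \<Omega> \<Longrightarrow> ext_fun c x > 0"
    using exterior_ball[OF domain] by blast
  have op: "open \<Omega>" "bounded \<Omega>" using domain by (auto simp: bounded_Ck_domain_def)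
  obtain R where R: "\<Omega> \<subseteq> ball 0 R" using bounded_subset_ballD[OF op(2), of 0] by blast
  interpret boundary_subsolution \<Omega> u p q "max R 1" c "real DIM('a)"
    using R c u pq dim sub op by unfold_locales auto
  show ?thesis by (rule nonpos[OF x])
qed

theorem theoremF:
  fixes \<Omega> :: "(real ^ 'n) set"
    and H :: "real ^ 'n \<Rightarrow> real \<Rightarrow> real ^ 'n \<Rightarrow> real"
    and u :: "real ^ 'n \<Rightarrow> real"
    and p q N :: real
  assumes N: "N = real CARD('n)" "N \<ge> 2"
    and domain: "bounded_Ck_domain 2 \<Omega>" "0 \<in> frontier \<Omega>"
    and H:
      "(p > 0 \<and> 0 \<le> q \<and> q \<le> 2 \<and> N * (p + q - 1) \<ge> p + 1 \<and>
          (\<forall>x\<in>\<Omega>. \<forall>t\<ge>0. \<forall>\<xi>. H x t \<xi> = rpow t p * rpow (norm \<xi>) q)) \<or>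
       (p \<ge> 1 \<and> 1 \<le> q \<and> q \<le> 2 \<and>
          max (ereal p) (if q = 2 then \<infinity> else ereal (q / (2 - q))) \<ge> ereal ((N + 1) / (N - 1)) \<and>
          (\<forall>x\<in>\<Omega>. \<forall>t\<ge>0. \<forall>\<xi>. H x t \<xi> = rpow t p + rpow (norm \<xi>) q))"
    and u: "nonneg_solution H \<Omega> u" "\<forall>x\<in>frontier \<Omega> - {0}. u x = 0"
  shows "\<forall>x\<in>closure \<Omega> - {0}. u x = 0"
proof -
  have op: "open \<Omega>" using domain by (simp add: bounded_Ck_domain_def)
  have sol: "continuous_on (closure \<Omega> - {0}) u" "Ck_on 2 u \<Omega>"
    "\<And>x. x \<in> closure \<Omega> - {0} \<Longrightarrow> u x \<ge> 0"
    "\<And>x. x \<in> \<Omega> \<Longrightarrow> laplacian u x = H x (u x) (gradient u x)"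
    using u(1) by (auto simp: nonneg_solution_def)
  have in_cl: "x \<in> closure \<Omega> - {0}" if "x \<in> \<Omega>" for x
    using that op domain(2) closure_subset[of \<Omega>] by (auto simp: frontier_def interior_open)
  have "\<exists>p' q'. p' \<ge> 0 \<and> q' \<ge> 0 \<and> N * (p' + q' - 1) \<ge> p' + 1 \<and>
      (\<forall>x\<in>\<Omega>. laplacian u x \<ge> rpow (u x) p' * rpow (norm (gradient u x)) q')"
    using H
  proof (elim disjE conjE)
    assume a: "p > 0" "0 \<le> q" "N * (p + q - 1) \<ge> p + 1"
      "\<forall>x\<in>\<Omega>. \<forall>t\<ge>0. \<forall>\<xi>. H x t \<xi> = rpow t p * rpow (norm \<xi>) q"
    then show ?thesis
      by (intro exI[of _ p] exI[of _ q]) (use sol in_cl in auto)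
  next
    assume b: "p \<ge> 1" "1 \<le> q" "q \<le> 2"
      "max (ereal p) (if q = 2 then \<infinity> else ereal (q / (2 - q))) \<ge> ereal ((N + 1) / (N - 1))"
      "\<forall>x\<in>\<Omega>. \<forall>t\<ge>0. \<forall>\<xi>. H x t \<xi> = rpow t p + rpow (norm \<xi>) q"
    have lap: "laplacian u x = rpow (u x) p + rpow (norm (gradient u x)) q" if "x \<in> \<Omega>" for x
      using sol(3)[OF in_cl[OF that]] sol(4)[OF that] b(5) that by simp
    \<comment> \<open>Whichever entry attains the maximum decides which term is kept. The lower
      bound on \<open>p\<close> is equivalent to N(p - 1) \<ge> p + 1, and that on q/(2 - q) to N(q
      - 1) \<ge> 1: the exponent condition with the other exponent 0. The dropped factor is
      \<open>rpow s 0 = 1\<close>, also at \<open>s = 0\<close>.\<close>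
    consider "p \<ge> (N + 1) / (N - 1)" | "q = 2" | "q < 2" "q / (2 - q) \<ge> (N + 1) / (N - 1)"
      using b(3,4) by (cases "q = 2") (auto simp: max_def split: if_splits)
    then show ?thesis
    proof cases
      case 1
      then have "N * (p + 0 - 1) \<ge> p + 1" using N(2) by (simp add: field_simps)
      then show ?thesis
        by (intro exI[of _ p] exI[of _ "0::real"]) (use b lap rpow_nonneg in \<open>auto simp: rpow_def[of _ 0]\<close>)
    next
      case 2
      then have "N * (0 + q - 1) \<ge> 0 + 1" using N(2) by simp
      then show ?thesis
        by (intro exI[of _ "0::real"] exI[of _ q]) (use b lap rpow_nonneg in \<open>auto simp: rpow_def[of _ 0]\<close>)
    next
      case 3
      then have "N * (0 + q - 1) \<ge> 0 + 1" using N(2) by (simp add: field_simps)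
      then show ?thesis
        by (intro exI[of _ "0::real"] exI[of _ q]) (use b lap rpow_nonneg in \<open>auto simp: rpow_def[of _ 0]\<close>)
    qed
  qed
  then obtain p' q' where pq: "p' \<ge> 0" "q' \<ge> 0" "N * (p' + q' - 1) \<ge> p' + 1"
    "\<And>x. x \<in> \<Omega> \<Longrightarrow> laplacian u x \<ge> rpow (u x) p' * rpow (norm (gradient u x)) q'" by blast
  have "u x \<le> 0" if "x \<in> \<Omega>" for x
    using subsolution_nonpos[OF _ domain sol(2,1) u(2) pq(1,2) _ pq(4) that] N pq(3) by simp
  then have "u x = 0" if "x \<in> \<Omega>" for x
    using sol(3)[OF in_cl[OF that]] that by (simp add: order_antisym)
  moreover have "x \<in> \<Omega> \<or> x \<in> frontier \<Omega> - {0}" if "x \<in> closure \<Omega> - {0}" for x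
    using that op by (auto simp: frontier_def interior_open)
  ultimately show ?thesis using u(2) by blast
qed

end
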